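(* Let $\Gamma$ be a countable group and consider a measure preserving, ergodic action of $\Gamma$ on a standard probability space $(X,\mu)$ with associated equivalence relation $F=E^X_\Gamma$. Let $E\subseteq F$ be a subequivalence relation. If $E$ is aperiodic and for some $S,S'\in[F]$, $\inf_{\gamma\in\Gamma}\varphi_E(S\gamma S')>\frac12$, then $C_\mu(F)\le C_\mu(E)$.
   Context: Everything is modulo null sets; equivalence relations are Borel. $E^X_\Gamma$ is the orbit equivalence relation; $\gamma\in\Gamma$ also denotes the automorphism $x\mapsto\gamma\cdot x$. $\mathrm{Aut}(X,\mu)$ is the group of measure preserving Borel automorphisms (modulo a.e. equality); $[F]=\{T\in\mathrm{Aut}(X,\mu):T(x)\,F\,x\ \mu\text{-a.e.}\}$; $\varphi_E(S)=\mu(\{x:S(x)\,E\,x\})$. $E$ is aperiodic if all its classes are infinite. $C_\mu(E)$ is the cost of $E$: the infimum over all graphings $\mathcal G$ of $E$ (Borel graphs on $X$ whose connected components are the $E$-classes a.e.) of $\frac12\int_X \deg_{\mathcal G}(x)\,d\mu(x)$. *)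

theory Defs
  imports "HOL-Probability.Probability" "HOL-Algebra.Group_Action"
begin

definition standard_probability_space :: "'x measure \<Rightarrow> bool" where
  "standard_probability_space M \<longleftrightarrow>
     prob_space M \<and>
     (\<exists>T. topspace T = space M \<and> completely_metrizable_space T \<and> second_countable T \<and>
          sets M = sigma_sets (space M) {U. openin T U})"

text \<open>Elements of \<open>Aut(X, \<mu>)\<close> are given by representatives that are everywhere bijective;
  values outside \<^term>\<open>space M\<close> are irrelevant.\<close>

definition mp_automorphism :: "'x measure \<Rightarrow> ('x \<Rightarrow> 'x) \<Rightarrow> bool" where
  "mp_automorphism M T \<longleftrightarrow>
     bij_betw T (space M) (space M) \<and>
     T \<in> M \<rightarrow>\<^sub>M M \<and> the_inv_into (space M) T \<in> M \<rightarrow>\<^sub>M M \<and>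
     distr M M T = M"

definition mp_action ::
    "('g, 'm) monoid_scheme \<Rightarrow> 'x measure \<Rightarrow> ('g \<Rightarrow> 'x \<Rightarrow> 'x) \<Rightarrow> bool" where
  "mp_action \<Gamma> M a \<longleftrightarrow>
     group_action \<Gamma> (space M) a \<and> (\<forall>\<gamma>\<in>carrier \<Gamma>. mp_automorphism M (a \<gamma>))"

definition ergodic_action ::
    "('g, 'm) monoid_scheme \<Rightarrow> 'x measure \<Rightarrow> ('g \<Rightarrow> 'x \<Rightarrow> 'x) \<Rightarrow> bool" where
  "ergodic_action \<Gamma> M a \<longleftrightarrow>
     (\<forall>A\<in>sets M. (\<forall>\<gamma>\<in>carrier \<Gamma>. a \<gamma> ` A = A) \<longrightarrow> measure M A = 0 \<or> measure M A = 1)"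

definition orbit_equivalence ::
    "('g, 'm) monoid_scheme \<Rightarrow> 'x measure \<Rightarrow> ('g \<Rightarrow> 'x \<Rightarrow> 'x) \<Rightarrow> ('x \<times> 'x) set" where
  "orbit_equivalence \<Gamma> M a = {(x, y). x \<in> space M \<and> y \<in> orbit \<Gamma> a x}"

definition borel_equivalence :: "'x measure \<Rightarrow> ('x \<times> 'x) set \<Rightarrow> bool" where
  "borel_equivalence M E \<longleftrightarrow> equiv (space M) E \<and> E \<in> sets (M \<Otimes>\<^sub>M M)"

text \<open>Everything is taken modulo null sets: inclusion of relations and infinitude of classes
  are required for the class of almost every point.\<close>

definition subrelation_ae :: "'x measure \<Rightarrow> ('x \<times> 'x) set \<Rightarrow> ('x \<times> 'x) set \<Rightarrow> bool" where
  "subrelation_ae M E F \<longleftrightarrow> (AE x in M. E `` {x} \<subseteq> F `` {x})"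

definition aperiodic :: "'x measure \<Rightarrow> ('x \<times> 'x) set \<Rightarrow> bool" where
  "aperiodic M E \<longleftrightarrow> (AE x in M. infinite (E `` {x}))"

definition full_group :: "'x measure \<Rightarrow> ('x \<times> 'x) set \<Rightarrow> ('x \<Rightarrow> 'x) set" where
  "full_group M F = {T. mp_automorphism M T \<and> (AE x in M. (T x, x) \<in> F)}"

definition phi :: "'x measure \<Rightarrow> ('x \<times> 'x) set \<Rightarrow> ('x \<Rightarrow> 'x) \<Rightarrow> real" where
  "phi M E T = measure M {x \<in> space M. (T x, x) \<in> E}"

text \<open>A graph is a symmetric irreflexive relation, so the connected component of \<open>x\<close> is
  the set of points reachable from \<open>x\<close>.\<close>

definition graphing :: "'x measure \<Rightarrow> ('x \<times> 'x) set \<Rightarrow> ('x \<times> 'x) set \<Rightarrow> bool" where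
  "graphing M E \<G> \<longleftrightarrow>
     \<G> \<in> sets (M \<Otimes>\<^sub>M M) \<and> sym \<G> \<and> irrefl \<G> \<and>
     (AE x in M. (\<G>\<^sup>*) `` {x} = E `` {x})"

text \<open>The counting measure makes the degree infinite at points with infinitely many
  neighbours.\<close>

definition degree :: "('x \<times> 'x) set \<Rightarrow> 'x \<Rightarrow> ennreal" where
  "degree \<G> x = emeasure (count_space UNIV) (\<G> `` {x})"

definition cost :: "'x measure \<Rightarrow> ('x \<times> 'x) set \<Rightarrow> ennreal" where
  "cost M E = (INF \<G>\<in>{\<G>. graphing M E \<G>}. (\<integral>\<^sup>+ x. degree \<G> x \<partial>M) / 2)"

end

theory Submission
  imports Defs
begin

text \<open>
Two facts carry the proof. Write \<open>F\<close> for the orbit equivalence relation.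

\<^emph>\<open>There is a set \<open>A\<close> of positive measure, invariant under \<open>E\<close>, on which \<open>E\<close> and \<open>F\<close> agree\<close>
(\<open>common_class_on_positive_set\<close>). Each \<open>\<gamma>\<close> gives a map \<open>x \<mapsto> [S (\<gamma> \<cdot> x)]\<close> sending a point to one of the
\<open>E\<close>-classes inside its \<open>F\<close>-class, that is, a unit vector in a field of Hilbert spaces
\<open>\<ell>\<^sup>2([x]\<^sub>F / E)\<close>. These vectors form an orbit of \<open>\<Gamma>\<close>, so the vector \<open>h\<close> of least norm in the closed convex
hull of the orbit is \<open>\<Gamma>\<close>-invariant: it is a function of the \<open>E\<close>-class alone. Along a
sequence of convex combinations whose norms decrease to the infimum fast enough, the convergence holds
almost everywhere, so no Hilbert space has to be constructed. Each convex combination assigns total weight 1 to the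
\<open>E\<close>-classes in an \<open>F\<close>-class, so \<open>h\<close> assigns total weight at most 1, and at most one \<open>E\<close>-class in each
\<open>F\<close>-class satisfies \<open>h > 1/2\<close>. Testing against \<open>S'\<close> shows that the integral of \<open>h\<close> is at least
the infimum of \<open>\<phi>\<^sub>E(S \<gamma> S')\<close>, hence exceeds \<open>1/2\<close>. So \<open>A = {x. h x > 1/2}\<close> works.

\<^emph>\<open>Such a set forces the cost inequality\<close> (\<open>cost_le_of_full_restriction\<close>). Given a graphing \<open>G\<close> of \<open>E\<close>,
keep \<open>G\<close> inside \<open>A\<close>, where it generates \<open>F\<close>, throw it away outside \<open>A\<close>, and join every point
outside \<open>A\<close> to \<open>A\<close> by a single edge of \<open>F\<close>, which exists by ergodicity. The new edges contribute \<open>2 \<mu>(X - A)\<close> to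
the integral of the degree. The part of \<open>G\<close> outside \<open>A\<close> has infinite components, and a graph
with infinite components contributes at least that much (\<open>aperiodic_graphing_degree\<close>), so nothing is lost.
\<close>

section \<open>Countable groups of measure preserving automorphisms\<close>

text \<open>A countable base of the topology separates points; it stands in for an embedding of the space
into the Cantor space.\<close>

lemma standard_probability_space_separating:
  assumes "standard_probability_space M"
  obtains U :: "nat \<Rightarrow> 'x set"
  where "\<And>n. U n \<in> sets M"
    and "\<And>x y. \<lbrakk>x \<in> space M; y \<in> space M; \<And>n. x \<in> U n \<longleftrightarrow> y \<in> U n\<rbrakk> \<Longrightarrow> x = y"
proof -
  obtain T where T: "topspace T = space M" "completely_metrizable_space T" "second_countable T"
    "sets M = sigma_sets (space M) {U. openin T U}"
    using assms unfolding standard_probability_space_def by blast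
  obtain \<B> where \<B>: "countable \<B>" "\<And>V. V \<in> \<B> \<Longrightarrow> openin T V"
    "\<And>U x. openin T U \<Longrightarrow> x \<in> U \<Longrightarrow> \<exists>V\<in>\<B>. x \<in> V \<and> V \<subseteq> U"
    using T(3) unfolding second_countable_def by metis
  have t1: "t1_space T"
    using T(2) completely_metrizable_imp_metrizable_space metrizable_imp_t1_space by blast
  define U where "U = from_nat_into (insert {} \<B>)"
  have rU: "range U = insert {} \<B>"
    unfolding U_def using \<B>(1) by (intro range_from_nat_into) auto
  show ?thesis
  proof
    fix n
    have "U n \<in> insert {} \<B>" using rU by auto
    then have "openin T (U n)" using \<B>(2) by auto
    then show "U n \<in> sets M" unfolding T(4) by auto
  next
    fix x y assume xy: "x \<in> space M" "y \<in> space M" and eq: "\<And>n. x \<in> U n \<longleftrightarrow> y \<in> U n"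
    show "x = y"
    proof (rule ccontr)
      assume "x \<noteq> y"
      then obtain W where "openin T W" "x \<in> W" "y \<notin> W"
        using t1 xy T(1) unfolding t1_space_def by metis
      then obtain V where "V \<in> \<B>" "x \<in> V" "y \<notin> V" using \<B>(3) by blast
      moreover then obtain n where "U n = V" using rU by (metis insertI2 rangeE)
      ultimately show False using eq by blast
    qed
  qed
qed

lemma emeasure_count_space_nat:
  "emeasure (count_space UNIV) (K :: nat set) = (\<Sum>n. indicator K n)"
  using nn_integral_count_space_nat[of "indicator K"] nn_integral_indicator[of K "count_space UNIV"]
  by (simp only: sets_count_space Pow_UNIV UNIV_I)

lemma emeasure_count_space_bij_betw:
  assumes "bij_betw f A B"
  shows "emeasure (count_space UNIV) A = emeasure (count_space UNIV) B"
  unfolding emeasure_count_space[OF subset_UNIV]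
  by (simp only: bij_betw_finite[OF assms] bij_betw_same_card[OF assms])

locale pmp_action = prob_space M + group \<Gamma>
  for \<Gamma> :: "('g, 'm) monoid_scheme" and M :: "'x measure" +
  fixes a :: "'g \<Rightarrow> 'x \<Rightarrow> 'x"
  assumes countable_group: "countable (carrier \<Gamma>)"
    and standard: "standard_probability_space M"
    and mp: "mp_action \<Gamma> M a"
begin

abbreviation F :: "('x \<times> 'x) set" where "F \<equiv> orbit_equivalence \<Gamma> M a"

sublocale group_action \<Gamma> "space M" a
  using mp unfolding mp_action_def by blast

lemma act_aut: "g \<in> carrier \<Gamma> \<Longrightarrow> mp_automorphism M (a g)"
  using mp unfolding mp_action_def by blast

lemma act_space: "g \<in> carrier \<Gamma> \<Longrightarrow> x \<in> space M \<Longrightarrow> a g x \<in> space M"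
  by (rule element_image) auto

lemma act_one: "x \<in> space M \<Longrightarrow> a \<one>\<^bsub>\<Gamma>\<^esub> x = x"
  using id_eq_one by (metis restrict_apply')

lemma act_mult:
  "g \<in> carrier \<Gamma> \<Longrightarrow> h \<in> carrier \<Gamma> \<Longrightarrow> x \<in> space M \<Longrightarrow> a (g \<otimes>\<^bsub>\<Gamma>\<^esub> h) x = a g (a h x)"
  by (simp add: composition_rule)

lemma act_inv: "g \<in> carrier \<Gamma> \<Longrightarrow> x \<in> space M \<Longrightarrow> a (inv\<^bsub>\<Gamma>\<^esub> g) (a g x) = x"
  by (metis act_mult act_one inv_closed l_inv)

lemma act_inv': "g \<in> carrier \<Gamma> \<Longrightarrow> x \<in> space M \<Longrightarrow> a g (a (inv\<^bsub>\<Gamma>\<^esub> g) x) = x"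
  by (metis act_mult act_one inv_closed r_inv)

lemma act_measurable[measurable (raw)]: "g \<in> carrier \<Gamma> \<Longrightarrow> a g \<in> M \<rightarrow>\<^sub>M M"
  using act_aut unfolding mp_automorphism_def by blast

lemma distr_act: "g \<in> carrier \<Gamma> \<Longrightarrow> distr M M (a g) = M"
  using act_aut unfolding mp_automorphism_def by blast

lemma nn_integral_act:
  assumes "g \<in> carrier \<Gamma>" and [measurable]: "u \<in> borel_measurable M"
  shows "(\<integral>\<^sup>+x. u (a g x) \<partial>M) = (\<integral>\<^sup>+x. u x \<partial>M)"
  using nn_integral_distr[of "a g" M M u] act_measurable[OF assms(1)] distr_act[OF assms(1)] by simp

lemma in_F_iff: "(x, y) \<in> F \<longleftrightarrow> x \<in> space M \<and> (\<exists>g\<in>carrier \<Gamma>. y = a g x)"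
  unfolding orbit_equivalence_def orbit_def by auto

lemma F_sym: "(x, y) \<in> F \<Longrightarrow> (y, x) \<in> F"
  unfolding in_F_iff using act_space act_inv by (metis inv_closed)

lemma F_trans: "(x, y) \<in> F \<Longrightarrow> (y, z) \<in> F \<Longrightarrow> (x, z) \<in> F"
  unfolding in_F_iff using act_mult by (metis m_closed)

lemma F_refl: "x \<in> space M \<Longrightarrow> (x, x) \<in> F"
  unfolding in_F_iff using act_one by (metis one_closed)

definition enum :: "nat \<Rightarrow> 'g" where "enum = from_nat_into (carrier \<Gamma>)"

definition T :: "nat \<Rightarrow> 'x \<Rightarrow> 'x" where "T n = a (enum n)"

lemma range_enum: "range enum = carrier \<Gamma>"
  unfolding enum_def using countable_group one_closed by (intro range_from_nat_into) auto

lemma enum_carrier[simp]: "enum n \<in> carrier \<Gamma>"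
  using range_enum by auto

lemma T_measurable[measurable]: "T n \<in> M \<rightarrow>\<^sub>M M"
  unfolding T_def by (rule act_measurable) simp

lemma T_space: "x \<in> space M \<Longrightarrow> T n x \<in> space M"
  unfolding T_def by (simp add: act_space)

lemma in_F_iff_T: "(x, y) \<in> F \<longleftrightarrow> x \<in> space M \<and> (\<exists>n. y = T n x)"
  unfolding in_F_iff T_def range_enum[symmetric] by auto

lemma AE_act:
  assumes "AE x in M. P x"
  shows "AE x in M. \<forall>g\<in>carrier \<Gamma>. P (a g x)"
proof (rule AE_ball_countable')
  fix g assume g: "g \<in> carrier \<Gamma>"
  show "AE x in M. P (a g x)"
    using AE_distrD[OF act_measurable[OF g], of P] assms by (subst (asm) distr_act[OF g]) blast
qed (rule countable_group)

text \<open>Since the group is countable, the saturation of a null set is null. This replaces a property that holds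
almost everywhere by one that holds everywhere on an invariant set.\<close>

lemma invariant_conull_set:
  assumes "AE x in M. P x"
  obtains X where "X \<in> sets M" "AE x in M. x \<in> X" "\<And>x. x \<in> X \<Longrightarrow> P x"
    "\<And>x y. x \<in> X \<Longrightarrow> (x, y) \<in> F \<Longrightarrow> y \<in> X"
proof -
  obtain N where N: "{x \<in> space M. \<not> P x} \<subseteq> N" "N \<in> sets M" "emeasure M N = 0"
    using assms by (auto elim: AE_E)
  note [measurable] = N(2)
  define X where "X = {x \<in> space M. \<forall>n. T n x \<notin> N}"
  have "AE x in M. x \<notin> N" using N by (auto intro!: AE_not_in simp: null_sets_def)
  from AE_act[OF this] have ae: "AE x in M. x \<in> X"
    by (auto simp: X_def T_def)
  show ?thesis
  proof (rule that[OF _ ae])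
    show "X \<in> sets M" unfolding X_def by measurable
    fix x assume x: "x \<in> X"
    have xs: "x \<in> space M" using x by (simp add: X_def)
    have inv: "y \<notin> N" if "(x, y) \<in> F" for y
      using x that by (auto simp: X_def in_F_iff_T)
    show "P x" using inv[OF F_refl[OF xs]] N(1) xs by auto
    fix y assume y: "(x, y) \<in> F"
    have "T n y \<notin> N" for n
    proof (rule inv)
      have "(y, T n y) \<in> F" using y xs by (auto simp: in_F_iff_T T_space)
      then show "(x, T n y) \<in> F" using y F_trans by blast
    qed
    moreover have "y \<in> space M" using y xs by (auto simp: in_F_iff_T T_space)
    ultimately show "y \<in> X" by (auto simp: X_def)
  qed
qed

lemma equal_points_measurable:
  assumes [measurable]: "f \<in> N \<rightarrow>\<^sub>M M" "g \<in> N \<rightarrow>\<^sub>M M"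
  shows "{x \<in> space N. f x = g x} \<in> sets N"
proof -
  obtain U where U[measurable]: "\<And>n::nat. U n \<in> sets M"
    and sep: "\<And>x y. \<lbrakk>x \<in> space M; y \<in> space M; \<And>n. x \<in> U n \<longleftrightarrow> y \<in> U n\<rbrakk> \<Longrightarrow> x = y"
    using standard_probability_space_separating[OF standard] by blast
  have "{x \<in> space N. f x = g x} = {x \<in> space N. \<forall>n. f x \<in> U n \<longleftrightarrow> g x \<in> U n}"
  proof (intro Collect_cong conj_cong refl iffI allI)
    fix x assume "x \<in> space N" "\<forall>n. f x \<in> U n \<longleftrightarrow> g x \<in> U n"
    then show "f x = g x"
      by (intro sep measurable_space[OF assms(1)] measurable_space[OF assms(2)]) auto
  qed simp_all
  also have "\<dots> \<in> sets N" by measurable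
  finally show ?thesis .
qed

section \<open>Degrees and mass transport\<close>

text \<open>Relations inside \<open>F\<close> are cut into countably many graphs of partial functions: a pair \<open>(x, y)\<close>
of \<open>R\<close> is counted at the least index \<open>n\<close> with \<open>T n x = y\<close>, so that repetitions in the
enumeration and nontrivial stabilizers cause no double counting.\<close>

definition first_hit :: "('x \<times> 'x) set \<Rightarrow> nat \<Rightarrow> 'x set" where
  "first_hit R n = {x \<in> space M. (x, T n x) \<in> R \<and> (\<forall>i<n. T i x \<noteq> T n x)}"

lemma pair_measurable:
  assumes R: "R \<in> sets (M \<Otimes>\<^sub>M M)" and [measurable]: "f \<in> M \<rightarrow>\<^sub>M M" "g \<in> M \<rightarrow>\<^sub>M M"
  shows "{x \<in> space M. (f x, g x) \<in> R} \<in> sets M"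
proof -
  have "(\<lambda>x. (f x, g x)) \<in> M \<rightarrow>\<^sub>M M \<Otimes>\<^sub>M M" by measurable
  from measurable_sets[OF this R] show ?thesis
    by (simp add: vimage_def Int_def conj_commute)
qed

lemma first_hit_measurable[measurable]:
  assumes "R \<in> sets (M \<Otimes>\<^sub>M M)"
  shows "first_hit R n \<in> sets M"
proof -
  have [measurable]: "{x \<in> space M. (x, T n x) \<in> R} \<in> sets M" "{x \<in> space M. T i x = T n x} \<in> sets M" for i
    by (intro pair_measurable equal_points_measurable assms; measurable)+
  have "first_hit R n = {x \<in> space M. x \<in> {x \<in> space M. (x, T n x) \<in> R}
      \<and> (\<forall>i. i < n \<longrightarrow> x \<notin> {x \<in> space M. T i x = T n x})}"
    unfolding first_hit_def by auto
  also have "\<dots> \<in> sets M" by measurable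
  finally show ?thesis .
qed

lemma degree_eq_sum:
  assumes "R \<subseteq> F" "x \<in> space M"
  shows "degree R x = (\<Sum>n. indicator (first_hit R n) x)"
proof -
  have "bij_betw (\<lambda>n. T n x) {n. x \<in> first_hit R n} (R `` {x})"
  proof (rule bij_betwI')
    fix m n assume "m \<in> {n. x \<in> first_hit R n}" "n \<in> {n. x \<in> first_hit R n}"
    then have "\<forall>i<m. T i x \<noteq> T m x" "\<forall>i<n. T i x \<noteq> T n x"
      unfolding first_hit_def by blast+
    then show "T m x = T n x \<longleftrightarrow> m = n"
      by (cases m n rule: linorder_cases) fastforce+
  next
    fix y assume y: "y \<in> R `` {x}"
    then have ex: "\<exists>n. y = T n x" using assms by (auto simp: in_F_iff_T)
    define n where "n = (LEAST n. y = T n x)"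
    have n: "y = T n x" unfolding n_def by (rule LeastI_ex[OF ex])
    moreover have "T i x \<noteq> T n x" if "i < n" for i
      using not_less_Least[of i "\<lambda>n. y = T n x"] that n unfolding n_def[symmetric] by auto
    ultimately show "\<exists>n\<in>{n. x \<in> first_hit R n}. y = T n x"
      using assms y unfolding first_hit_def by auto
  qed (auto simp: first_hit_def)
  from emeasure_count_space_bij_betw[OF this, symmetric] show ?thesis
    unfolding degree_def by (simp add: emeasure_count_space_nat indicator_def)
qed

lemma degree_measurable:
  assumes [measurable]: "R \<in> sets (M \<Otimes>\<^sub>M M)" and "R \<subseteq> F"
  shows "degree R \<in> borel_measurable M"
proof -
  have "(\<lambda>x. \<Sum>n. indicator (first_hit R n) x :: ennreal) \<in> borel_measurable M"
    by measurable
  then show ?thesis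
    by (subst measurable_cong[OF degree_eq_sum[OF assms(2)]])
qed

text \<open>A predecessor \<open>x\<close> of \<open>y\<close> in \<open>R\<close> is determined by the index at which the pair is counted, since
\<open>T n\<close> is injective. So the same pieces that count the successors of \<open>x\<close> count the predecessors of \<open>y\<close>,
only moved by the inverse of \<open>T n\<close>.\<close>

lemma degree_converse_eq_sum:
  assumes "R \<subseteq> F" "y \<in> space M"
  shows "degree (R\<inverse>) y = (\<Sum>n. indicator (first_hit R n) (a (inv\<^bsub>\<Gamma>\<^esub> (enum n)) y))"
proof -
  let ?i = "\<lambda>n. a (inv\<^bsub>\<Gamma>\<^esub> (enum n)) y"
  have Ti: "T n (?i n) = y" for n unfolding T_def using assms(2) by (simp add: act_inv')
  have iT: "x = ?i n" if "x \<in> space M" "T n x = y" for x n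
    using that unfolding T_def by (auto simp: act_inv)
  have "bij_betw ?i {n. ?i n \<in> first_hit R n} (R\<inverse> `` {y})"
  proof (rule bij_betwI')
    fix m n assume "m \<in> {n. ?i n \<in> first_hit R n}" "n \<in> {n. ?i n \<in> first_hit R n}"
    then have mn: "\<forall>i<m. T i (?i m) \<noteq> y" "\<forall>i<n. T i (?i n) \<noteq> y"
      unfolding first_hit_def by (auto simp: Ti)
    show "?i m = ?i n \<longleftrightarrow> m = n"
    proof
      assume "?i m = ?i n"
      then have "\<not> m < n" "\<not> n < m" using mn Ti by metis+
      then show "m = n" by simp
    qed simp
  next
    fix n assume "n \<in> {n. ?i n \<in> first_hit R n}"
    then show "?i n \<in> R\<inverse> `` {y}" unfolding first_hit_def by (auto simp: Ti)
  next
    fix x assume x: "x \<in> R\<inverse> `` {y}"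
    then have xR: "(x, y) \<in> R" by auto
    then have ex: "\<exists>n. y = T n x" and xs: "x \<in> space M" using assms by (auto simp: in_F_iff_T)
    define n where "n = (LEAST n. y = T n x)"
    have n: "y = T n x" unfolding n_def by (rule LeastI_ex[OF ex])
    moreover have "T i x \<noteq> T n x" if "i < n" for i
      using not_less_Least[of i "\<lambda>n. y = T n x"] that n unfolding n_def[symmetric] by auto
    ultimately have "x \<in> first_hit R n" using xs xR unfolding first_hit_def by auto
    moreover have "x = ?i n" using iT xs n by simp
    ultimately show "\<exists>n\<in>{n. ?i n \<in> first_hit R n}. x = ?i n" by (intro bexI[of _ n]) auto
  qed
  from emeasure_count_space_bij_betw[OF this, symmetric] show ?thesis
    unfolding degree_def by (simp add: emeasure_count_space_nat indicator_def)
qed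

text \<open>Each of the partial functions that make up \<open>R\<close> preserves the measure, so the mean number of
predecessors equals the mean number of successors.\<close>

theorem mass_transport:
  assumes [measurable]: "R \<in> sets (M \<Otimes>\<^sub>M M)" and "R \<subseteq> F"
  shows "(\<integral>\<^sup>+x. degree (R\<inverse>) x \<partial>M) = (\<integral>\<^sup>+x. degree R x \<partial>M)"
proof -
  have [measurable]: "a (inv\<^bsub>\<Gamma>\<^esub> (enum n)) \<in> M \<rightarrow>\<^sub>M M" for n by (rule act_measurable) simp
  have "(\<integral>\<^sup>+x. degree (R\<inverse>) x \<partial>M)
      = (\<integral>\<^sup>+x. (\<Sum>n. indicator (first_hit R n) (a (inv\<^bsub>\<Gamma>\<^esub> (enum n)) x)) \<partial>M)"
    by (intro nn_integral_cong degree_converse_eq_sum assms)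
  also have "\<dots> = (\<Sum>n. \<integral>\<^sup>+x. indicator (first_hit R n) (a (inv\<^bsub>\<Gamma>\<^esub> (enum n)) x) \<partial>M)"
    by (intro nn_integral_suminf) measurable
  also have "\<dots> = (\<Sum>n. \<integral>\<^sup>+x. indicator (first_hit R n) x \<partial>M)"
    by (intro suminf_cong nn_integral_act) auto
  also have "\<dots> = (\<integral>\<^sup>+x. (\<Sum>n. indicator (first_hit R n) x) \<partial>M)"
    by (intro nn_integral_suminf[symmetric]) measurable
  also have "\<dots> = (\<integral>\<^sup>+x. degree R x \<partial>M)"
    by (intro nn_integral_cong degree_eq_sum[symmetric] assms)
  finally show ?thesis .
qed

lemma converse_measurable:
  assumes D: "D \<in> sets (M \<Otimes>\<^sub>M M)"
  shows "D\<inverse> \<in> sets (M \<Otimes>\<^sub>M M)"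
proof -
  have "(\<lambda>(x, y). (y, x)) -` D \<inter> space (M \<Otimes>\<^sub>M M) \<in> sets (M \<Otimes>\<^sub>M M)"
    by (rule measurable_sets[OF measurable_pair_swap' D])
  moreover have "D \<subseteq> space M \<times> space M" using sets.sets_into_space[OF D] by (simp add: space_pair_measure)
  then have "(\<lambda>(x, y). (y, x)) -` D \<inter> space (M \<Otimes>\<^sub>M M) = D\<inverse>"
    by (auto simp: space_pair_measure)
  ultimately show ?thesis by simp
qed

lemma degree_mono: "R \<subseteq> R' \<Longrightarrow> degree R x \<le> degree R' x"
  unfolding degree_def by (intro emeasure_mono) auto

lemma degree_Un_le: "degree (R \<union> R') x \<le> degree R x + degree R' x"
proof -
  have "(R \<union> R') `` {x} = R `` {x} \<union> R' `` {x}" by blast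
  then show ?thesis unfolding degree_def by (simp add: emeasure_subadditive)
qed

section \<open>Graphings of aperiodic relations\<close>

lemma infinite_section_measurable:
  assumes [measurable]: "R \<in> sets (M \<Otimes>\<^sub>M M)" and "R \<subseteq> F"
  shows "{x \<in> space M. infinite (R `` {x})} \<in> sets M"
proof -
  note [measurable] = degree_measurable[OF assms]
  have "{x \<in> space M. infinite (R `` {x})} = {x \<in> space M. degree R x = \<infinity>}"
    by (auto simp: degree_def emeasure_count_space)
  also have "\<dots> \<in> sets M" by measurable
  finally show ?thesis .
qed

text \<open>Let every point send mass 1 to the point of \<open>A\<close> in its class, if there is one. The mass sent is at most 1, but
every point of \<open>A\<close> receives infinite mass.\<close>

lemma null_of_one_point_per_class:
  assumes [measurable]: "E \<in> sets (M \<Otimes>\<^sub>M M)" "A \<in> sets M" and EF: "E \<subseteq> F" and eq: "equiv Y E"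
    and inf: "\<And>x. x \<in> A \<Longrightarrow> infinite (E `` {x})"
    and one: "\<And>x y. x \<in> A \<Longrightarrow> y \<in> A \<Longrightarrow> (x, y) \<in> E \<Longrightarrow> x = y"
  shows "emeasure M A = 0"
proof -
  define R where "R = E \<inter> (space M \<times> A)"
  have R[measurable]: "R \<in> sets (M \<Otimes>\<^sub>M M)" unfolding R_def by measurable
  have RF: "R \<subseteq> F" using EF by (auto simp: R_def)
  have sE: "sym E" and tE: "trans E" using eq by (auto elim: equivE)
  have le1: "degree R x \<le> 1" for x
  proof (cases "R `` {x} = {}")
    case False
    then obtain y where "(x, y) \<in> E" "y \<in> A" by (auto simp: R_def)
    then have "R `` {x} \<subseteq> {y}"
      using one sE tE unfolding R_def by (auto dest: symD transD)
    then have "degree R x \<le> emeasure (count_space UNIV) {y}"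
      unfolding degree_def by (intro emeasure_mono) auto
    then show ?thesis by simp
  qed (simp add: degree_def)
  have infty: "degree (R\<inverse>) y = \<infinity>" if "y \<in> A" for y
  proof -
    have "R\<inverse> `` {y} = E `` {y}"
      using EF that sE by (auto simp: R_def in_F_iff dest: symD)
    then show ?thesis using inf[OF that] by (simp add: degree_def emeasure_count_space)
  qed
  have "\<infinity> * emeasure M A = (\<integral>\<^sup>+x. \<infinity> * indicator A x \<partial>M)"
    by (simp add: nn_integral_cmult_indicator)
  also have "\<dots> \<le> (\<integral>\<^sup>+x. degree (R\<inverse>) x \<partial>M)"
    using infty by (intro nn_integral_mono) (auto simp: indicator_def)
  also have "\<dots> = (\<integral>\<^sup>+x. degree R x \<partial>M)" by (rule mass_transport) (fact R RF)+
  also have "\<dots> \<le> (\<integral>\<^sup>+x. 1 \<partial>M)" by (intro nn_integral_mono le1)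
  also have "\<dots> = 1" by (simp add: emeasure_space_1)
  finally have "\<infinity> * emeasure M A \<le> 1" .
  then show ?thesis by (cases "emeasure M A = 0") (auto simp: ennreal_top_mult top_unique)
qed

text \<open>The marker lemma. Starting from \<open>Y\<close>, each class decides for each \<open>U n\<close> of a separating sequence whether
to keep the points inside or those outside \<open>U n\<close>, and prefers the inside whenever this leaves infinitely many points. The
resulting sets decrease and meet every class infinitely often, while points of the same class in their intersection lie in the same
sets \<open>U n\<close>, hence coincide. So the intersection is null.\<close>

lemma small_complete_section:
  assumes Y[measurable]: "Y \<in> sets M" and E[measurable]: "E \<in> sets (M \<Otimes>\<^sub>M M)"
    and EF: "E \<subseteq> F" and eq: "equiv Y E"
    and inf: "\<And>x. x \<in> Y \<Longrightarrow> infinite (E `` {x})" and "0 < (\<epsilon>::real)"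
  obtains B where "B \<in> sets M" "B \<subseteq> Y" "measure M B < \<epsilon>" "\<And>x. x \<in> Y \<Longrightarrow> E `` {x} \<inter> B \<noteq> {}"
proof -
  obtain U where U[measurable]: "\<And>n::nat. U n \<in> sets M"
    and sep: "\<And>x y. \<lbrakk>x \<in> space M; y \<in> space M; \<And>n. x \<in> U n \<longleftrightarrow> y \<in> U n\<rbrakk> \<Longrightarrow> x = y"
    using standard_probability_space_separating[OF standard] by blast
  have Ysp: "Y \<subseteq> space M" using sets.sets_into_space[OF Y] .
  define A where "A = rec_nat Y (\<lambda>n A. {x \<in> A. x \<in> U n \<longleftrightarrow> infinite (E `` {x} \<inter> (A \<inter> U n))})"
  have A0: "A 0 = Y" by (simp add: A_def)
  have AS: "A (Suc n) = {x \<in> A n. x \<in> U n \<longleftrightarrow> infinite (E `` {x} \<inter> (A n \<inter> U n))}" for n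
    by (simp add: A_def)
  have dec: "decseq A" by (intro decseq_SucI) (auto simp: AS)
  have AY: "A n \<subseteq> Y" for n using decseqD[OF dec, of 0 n] A0 by simp
  have meas[measurable]: "A n \<in> sets M" for n
  proof (induction n)
    case (Suc n)
    note [measurable] = Suc
    have "E \<inter> (space M \<times> (A n \<inter> U n)) \<in> sets (M \<Otimes>\<^sub>M M)" by measurable
    from infinite_section_measurable[OF this]
    have [measurable]: "{x \<in> space M. infinite ((E \<inter> (space M \<times> (A n \<inter> U n))) `` {x})} \<in> sets M"
      using EF by blast
    have "A (Suc n) = {x \<in> space M. x \<in> A n \<and>
        (x \<in> U n \<longleftrightarrow> x \<in> {x \<in> space M. infinite ((E \<inter> (space M \<times> (A n \<inter> U n))) `` {x})})}"
    proof -
      have "(E \<inter> (space M \<times> (A n \<inter> U n))) `` {x} = E `` {x} \<inter> (A n \<inter> U n)" if "x \<in> space M" for x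
        using that by auto
      moreover have "A n \<subseteq> space M" using AY[of n] Ysp by blast
      ultimately show ?thesis unfolding AS by auto
    qed
    also have "\<dots> \<in> sets M" by measurable
    finally show ?case .
  qed (simp add: A0)
  have infA: "infinite (E `` {x} \<inter> A n)" if x: "x \<in> Y" for x n
  proof (induction n)
    case 0
    have "E `` {x} \<inter> A 0 = E `` {x}" using eq by (auto simp: A0 elim!: equivE)
    then show ?case using inf x by simp
  next
    case (Suc n)
    have cls: "E `` {y} = E `` {x}" if "y \<in> E `` {x}" for y
      using equiv_class_eq[OF eq, of x y] that by simp
    show ?case
    proof (cases "infinite (E `` {x} \<inter> (A n \<inter> U n))")
      case True
      then have "E `` {x} \<inter> (A n \<inter> U n) \<subseteq> E `` {x} \<inter> A (Suc n)"
        using cls by (auto simp: AS)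
      then show ?thesis using True finite_subset by blast
    next
      case False
      then have "E `` {x} \<inter> A n - E `` {x} \<inter> (A n \<inter> U n) \<subseteq> E `` {x} \<inter> A (Suc n)"
        using cls by (auto simp: AS)
      moreover have "infinite (E `` {x} \<inter> A n - E `` {x} \<inter> (A n \<inter> U n))"
        using False Suc by (simp add: Diff_infinite_finite)
      ultimately show ?thesis using finite_subset by blast
    qed
  qed
  have "emeasure M (\<Inter>n. A n) = 0"
  proof (rule null_of_one_point_per_class[OF E _ EF eq])
    show "(\<Inter>n. A n) \<in> sets M" by measurable
    show "infinite (E `` {x})" if "x \<in> (\<Inter>n. A n)" for x using that inf AY by blast
    fix x y assume x: "x \<in> (\<Inter>n. A n)" and y: "y \<in> (\<Inter>n. A n)" and xy: "(x, y) \<in> E"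
    have "E `` {x} = E `` {y}" using equiv_class_eq[OF eq xy] .
    moreover have "x \<in> A (Suc n)" "y \<in> A (Suc n)" for n using x y by blast+
    ultimately have "x \<in> U n \<longleftrightarrow> y \<in> U n" for n unfolding AS mem_Collect_eq by metis
    moreover have "x \<in> space M" "y \<in> space M" using x y AY[of 0] Ysp by blast+
    ultimately show "x = y" by (intro sep) auto
  qed
  moreover have "(\<lambda>n. measure M (A n)) \<longlonglongrightarrow> measure M (\<Inter>n. A n)"
    by (intro finite_Lim_measure_decseq dec) auto
  ultimately have "(\<lambda>n. measure M (A n)) \<longlonglongrightarrow> 0" by (simp add: measure_def)
  from order_tendstoD(2)[OF this \<open>0 < \<epsilon>\<close>] obtain n where "measure M (A n) < \<epsilon>"
    by (auto simp: eventually_sequentially)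
  then show ?thesis
    using infA[of _ n] by (intro that[of "A n"] AY meas) (auto, metis finite.emptyI)
qed

lemma rtrancl_restrict:
  assumes "\<And>x. x \<in> Y \<Longrightarrow> G\<^sup>* `` {x} \<subseteq> Y" "(x, y) \<in> G\<^sup>*" "x \<in> Y"
  shows "(x, y) \<in> (G \<inter> Y \<times> Y)\<^sup>*"
  using assms(2)
proof induction
  case (step y z)
  have "(x, z) \<in> G\<^sup>*" using step.hyps by (rule rtrancl_into_rtrancl)
  with step.hyps(1) have "y \<in> Y" "z \<in> Y" using assms(1)[OF assms(3)] by auto
  with step.hyps(2) have "(y, z) \<in> G \<inter> Y \<times> Y" by simp
  with step.IH show ?case by (rule rtrancl_into_rtrancl)
qed simp

text \<open>An aperiodic relation has cost at least its measure. Fix a complete section \<open>B\<close> of small measure and orient edges towards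
\<open>B\<close> according to the graph distance. Every point outside \<open>B\<close> has an outgoing edge, so the mean number of outgoing edges is at
least \<open>\<mu>(Y - B)\<close>; by mass transport so is the mean number of incoming edges, and no edge is both.\<close>

theorem aperiodic_graphing_degree:
  assumes Y[measurable]: "Y \<in> sets M" and E: "E \<in> sets (M \<Otimes>\<^sub>M M)"
    and EF: "E \<subseteq> F" and eq: "equiv Y E"
    and inf: "\<And>x. x \<in> Y \<Longrightarrow> infinite (E `` {x})"
    and G[measurable]: "G \<in> sets (M \<Otimes>\<^sub>M M)" and symG: "sym G"
    and comp: "\<And>x. x \<in> Y \<Longrightarrow> G\<^sup>* `` {x} = E `` {x}" and GY: "G \<subseteq> Y \<times> Y"
  shows "2 * emeasure M Y \<le> (\<integral>\<^sup>+x. degree G x \<partial>M)"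
proof (rule ennreal_le_epsilon)
  fix \<epsilon> :: real assume "0 < \<epsilon>"
  then have "0 < \<epsilon> / 2" by simp
  from small_complete_section[OF Y E EF eq inf this]
  obtain B where B[measurable]: "B \<in> sets M" and BY: "B \<subseteq> Y" and Bm: "measure M B < \<epsilon> / 2"
    and meet: "\<And>x. x \<in> Y \<Longrightarrow> E `` {x} \<inter> B \<noteq> {}" by blast
  have Ysp: "Y \<subseteq> space M" using sets.sets_into_space[OF Y] .
  have GF: "G \<subseteq> F" using comp GY EF by blast
  \<comment> \<open>\<open>R k\<close> consists of the points at distance at most \<open>k\<close> from \<open>B\<close>, and \<open>D\<close> of the edges
    that decrease the distance.\<close>
  define R where "R = rec_nat B (\<lambda>k R. R \<union> {x \<in> space M. \<exists>n. T n x \<in> R \<and> (x, T n x) \<in> G})"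
  have R0: "R 0 = B" by (simp add: R_def)
  have RS: "R (Suc k) = R k \<union> {x \<in> space M. \<exists>n. T n x \<in> R k \<and> (x, T n x) \<in> G}" for k
    by (simp add: R_def)
  have [measurable]: "{x \<in> space M. (x, T n x) \<in> G} \<in> sets M" for n
    by (intro pair_measurable G) measurable
  have [measurable]: "R k \<in> sets M" for k
  proof (induction k)
    case (Suc k)
    note [measurable] = Suc
    have "R (Suc k) = R k \<union> {x \<in> space M. \<exists>n. T n x \<in> R k \<and> x \<in> {x \<in> space M. (x, T n x) \<in> G}}"
      by (auto simp: RS)
    also have "\<dots> \<in> sets M" by measurable
    finally show ?case .
  qed (simp add: R0)
  have mono: "R k \<subseteq> R l" if "k \<le> l" for k l
    using that by (rule lift_Suc_mono_le[rotated]) (auto simp: RS)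
  define D where "D = (\<Union>k. G \<inter> ((R (Suc k) - R k) \<times> R k))"
  have D[measurable]: "D \<in> sets (M \<Otimes>\<^sub>M M)" unfolding D_def by measurable
  have DG: "D \<subseteq> G" by (auto simp: D_def)
  then have DF: "D \<subseteq> F" using GF by blast
  have anti: "D \<inter> D\<inverse> = {}"
  proof -
    have False if "x \<in> R (Suc k)" "x \<notin> R k" "y \<in> R k" "y \<in> R (Suc l)" "y \<notin> R l" "x \<in> R l" for x y k l
      using that mono[of k l] mono[of l k] by (cases "k \<le> l") auto
    then show ?thesis unfolding D_def by blast
  qed
  have reach: "\<exists>k. x \<in> R k" if x: "x \<in> Y" for x
  proof -
    obtain b where "(x, b) \<in> G\<^sup>*" "b \<in> B" using meet[OF x] comp[OF x] by blast
    then show ?thesis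
    proof (induction rule: converse_rtrancl_induct)
      case base
      then show ?case using R0 by blast
    next
      case (step x y)
      then obtain k where "y \<in> R k" by blast
      moreover have "(x, y) \<in> F" using step GF by blast
      ultimately have "x \<in> R (Suc k)" using step unfolding RS by (auto simp: in_F_iff_T)
      then show ?case by blast
    qed
  qed
  have out: "indicator (Y - B) x \<le> degree D x" for x
  proof (cases "x \<in> Y - B")
    case True
    define k where "k = (LEAST k. x \<in> R k)"
    have k: "x \<in> R k" using LeastI_ex[of "\<lambda>k. x \<in> R k"] reach True unfolding k_def by blast
    have "k \<noteq> 0" using k True R0 by (metis DiffD2)
    then obtain j where j: "k = Suc j" by (cases k) auto
    have "x \<notin> R j" using not_less_Least[of j "\<lambda>k. x \<in> R k"] j unfolding k_def by auto
    moreover then obtain y where "y \<in> R j" "(x, y) \<in> G" using k unfolding j RS by auto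
    ultimately have "(x, y) \<in> D" using k unfolding j D_def by blast
    then have "emeasure (count_space UNIV) {y} \<le> degree D x"
      unfolding degree_def by (intro emeasure_mono) auto
    then show ?thesis using True by simp
  qed simp
  have deg: "degree D x + degree (D\<inverse>) x \<le> degree G x" for x
  proof -
    have "degree D x + degree (D\<inverse>) x = emeasure (count_space UNIV) (D `` {x} \<union> D\<inverse> `` {x})"
      unfolding degree_def using anti by (intro plus_emeasure) auto
    also have "\<dots> \<le> degree G x"
      unfolding degree_def using DG symG by (intro emeasure_mono) (auto dest: symD)
    finally show ?thesis .
  qed
  have [measurable]: "degree D \<in> borel_measurable M" by (rule degree_measurable[OF D DF])
  have "D\<inverse> \<in> sets (M \<Otimes>\<^sub>M M)" by (rule converse_measurable[OF D])
  then have [measurable]: "degree (D\<inverse>) \<in> borel_measurable M"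
    using DF F_sym by (intro degree_measurable) auto
  have "2 * emeasure M (Y - B) = 2 * (\<integral>\<^sup>+x. indicator (Y - B) x \<partial>M)" by simp
  also have "\<dots> \<le> 2 * (\<integral>\<^sup>+x. degree D x \<partial>M)"
    by (intro mult_left_mono nn_integral_mono out) auto
  also have "\<dots> = (\<integral>\<^sup>+x. degree D x \<partial>M) + (\<integral>\<^sup>+x. degree (D\<inverse>) x \<partial>M)"
    by (simp add: mass_transport[OF D DF] mult_2)
  also have "\<dots> = (\<integral>\<^sup>+x. degree D x + degree (D\<inverse>) x \<partial>M)"
    by (rule nn_integral_add[symmetric]) measurable
  also have "\<dots> \<le> (\<integral>\<^sup>+x. degree G x \<partial>M)" by (intro nn_integral_mono deg)
  finally have main: "2 * emeasure M (Y - B) \<le> (\<integral>\<^sup>+x. degree G x \<partial>M)" .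
  have "2 * emeasure M Y = 2 * emeasure M (Y - B) + 2 * emeasure M B"
  proof -
    have "emeasure M (Y - B) + emeasure M B = emeasure M ((Y - B) \<union> B)"
      by (intro plus_emeasure) auto
    also have "(Y - B) \<union> B = Y" using BY by blast
    finally show ?thesis by (simp only: distrib_left[symmetric])
  qed
  also have "2 * emeasure M B \<le> ennreal \<epsilon>"
  proof -
    have "2 * emeasure M B = ennreal (2 * measure M B)"
      by (simp add: emeasure_eq_measure ennreal_mult)
    also have "\<dots> \<le> ennreal \<epsilon>" using Bm by (intro ennreal_leI) simp
    finally show ?thesis .
  qed
  finally show "2 * emeasure M Y \<le> (\<integral>\<^sup>+x. degree G x \<partial>M) + ennreal \<epsilon>"
    using main by (meson add_mono order_trans order_refl)
qed

section \<open>Cost and restriction to an invariant set\<close>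

lemma ergodic_saturation:
  assumes erg: "ergodic_action \<Gamma> M a" and A[measurable]: "A \<in> sets M" and pos: "0 < measure M A"
  shows "AE x in M. \<exists>n. T n x \<in> A"
proof -
  define W where "W = {x \<in> space M. \<exists>n. T n x \<in> A}"
  have W[measurable]: "W \<in> sets M" unfolding W_def by measurable
  have closed: "y \<in> W" if xy: "(x, y) \<in> F" and x: "x \<in> W" for x y
  proof -
    obtain n where "T n x \<in> A" using x by (auto simp: W_def)
    moreover have "(x, T n x) \<in> F" using x by (auto simp: W_def in_F_iff_T)
    ultimately obtain z where "z \<in> A" "(y, z) \<in> F" using F_trans[OF F_sym[OF xy]] by blast
    then show ?thesis unfolding W_def in_F_iff_T by blast
  qed
  have "a g ` W = W" if g: "g \<in> carrier \<Gamma>" for g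
  proof
    have Ws: "x \<in> space M" if "x \<in> W" for x using that by (simp add: W_def)
    show "a g ` W \<subseteq> W" using closed Ws g by (auto simp: in_F_iff)
    show "W \<subseteq> a g ` W"
    proof
      fix x assume x: "x \<in> W"
      have "a (inv\<^bsub>\<Gamma>\<^esub> g) x \<in> W"
        by (rule closed[OF _ x]) (use g Ws[OF x] in \<open>auto simp: in_F_iff\<close>)
      moreover have "x = a g (a (inv\<^bsub>\<Gamma>\<^esub> g) x)" using act_inv'[OF g Ws[OF x]] by simp
      ultimately show "x \<in> a g ` W" by blast
    qed
  qed
  then have "measure M W = 0 \<or> measure M W = 1" using erg W unfolding ergodic_action_def by blast
  moreover have "A \<subseteq> W"
  proof
    fix x assume x: "x \<in> A"
    then have xs: "x \<in> space M" using sets.sets_into_space[OF A] by blast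
    from F_refl[OF this] obtain n where "T n x = x" unfolding in_F_iff_T by metis
    then have "T n x \<in> A" using x by simp
    with xs show "x \<in> W" by (auto simp: W_def)
  qed
  then have "measure M A \<le> measure M W" by (intro finite_measure_mono W)
  ultimately have "prob W = 1" using pos by linarith
  then have "AE x in M. x \<in> W" using prob_eq_1[OF W] by simp
  then show ?thesis by eventually_elim (auto simp: W_def)
qed

text \<open>The new graphing spends exactly one edge for each point outside \<open>A\<close>, which is the least any graphing of
an aperiodic relation can spend there.\<close>

theorem cost_le_of_full_restriction:
  assumes erg: "ergodic_action \<Gamma> M a" and E: "borel_equivalence M E"
    and sub: "subrelation_ae M E F" and ap: "aperiodic M E"
    and A[measurable]: "A \<in> sets M" and pos: "0 < measure M A"
    and inv: "AE x in M. \<forall>y. (x, y) \<in> E \<longrightarrow> (x \<in> A \<longleftrightarrow> y \<in> A)"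
    and full: "AE x in M. x \<in> A \<longrightarrow> (\<forall>y. (x, y) \<in> F \<longrightarrow> y \<in> A \<longrightarrow> (x, y) \<in> E)"
  shows "cost M F \<le> cost M E"
  unfolding cost_def[of M E]
proof (rule INF_greatest)
  fix G assume "G \<in> {G. graphing M E G}"
  then have G[measurable]: "G \<in> sets (M \<Otimes>\<^sub>M M)" and symG: "sym G" and irrG: "irrefl G"
    and comp: "AE x in M. G\<^sup>* `` {x} = E `` {x}" by (auto simp: graphing_def)
  have E_meas[measurable]: "E \<in> sets (M \<Otimes>\<^sub>M M)" and eqE: "equiv (space M) E"
    using E by (auto simp: borel_equivalence_def)
  have "AE x in M. E `` {x} \<subseteq> F `` {x} \<and> infinite (E `` {x}) \<and> G\<^sup>* `` {x} = E `` {x}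
      \<and> (\<forall>y. (x, y) \<in> E \<longrightarrow> (x \<in> A \<longleftrightarrow> y \<in> A))
      \<and> (x \<in> A \<longrightarrow> (\<forall>y. (x, y) \<in> F \<longrightarrow> y \<in> A \<longrightarrow> (x, y) \<in> E)) \<and> (\<exists>n. T n x \<in> A)"
    using sub ap comp inv full ergodic_saturation[OF erg A pos]
    unfolding subrelation_ae_def aperiodic_def by eventually_elim blast
  from invariant_conull_set[OF this] obtain X where X[measurable]: "X \<in> sets M"
    and X_ae: "AE x in M. x \<in> X"
    and good: "\<And>x. x \<in> X \<Longrightarrow> E `` {x} \<subseteq> F `` {x} \<and> infinite (E `` {x}) \<and> G\<^sup>* `` {x} = E `` {x}
      \<and> (\<forall>y. (x, y) \<in> E \<longrightarrow> (x \<in> A \<longleftrightarrow> y \<in> A))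
      \<and> (x \<in> A \<longrightarrow> (\<forall>y. (x, y) \<in> F \<longrightarrow> y \<in> A \<longrightarrow> (x, y) \<in> E)) \<and> (\<exists>n. T n x \<in> A)"
    and XF: "\<And>x y. x \<in> X \<Longrightarrow> (x, y) \<in> F \<Longrightarrow> y \<in> X" by blast
  have Xsp: "x \<in> space M" if "x \<in> X" for x using sets.sets_into_space[OF X] that by blast
  have EF: "(x, y) \<in> F" if "x \<in> X" "(x, y) \<in> E" for x y using good[OF that(1)] that(2) by blast
  \<comment> \<open>Up to a null set, \<open>B\<close> is \<open>A\<close> and \<open>Y\<close> is its complement. Both are \<open>E\<close>-invariant, so \<open>G\<close> splits
    into its restrictions to them.\<close>
  define B Y where "B = A \<inter> X" and "Y = X - A"
  have [measurable]: "B \<in> sets M" "Y \<in> sets M" by (auto simp: B_def Y_def)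
  have Bclosed: "E `` {x} \<subseteq> B" if "x \<in> B" for x
    using that good[of x] EF XF[of x] unfolding B_def by blast
  have Yclosed: "E `` {x} \<subseteq> Y" if "x \<in> Y" for x
    using that good[of x] EF XF[of x] unfolding Y_def by blast
  have GE: "G\<^sup>* `` {x} = E `` {x}" if "x \<in> X" for x using good[OF that] by blast
  have B_closed: "G\<^sup>* `` {x} \<subseteq> B" if "x \<in> B" for x
    using Bclosed[OF that] GE[of x] that by (simp add: B_def)
  have Y_closed: "G\<^sup>* `` {x} \<subseteq> Y" if "x \<in> Y" for x
    using Yclosed[OF that] GE[of x] that by (simp add: Y_def)
  define GB GY where "GB = G \<inter> B \<times> B" and "GY = G \<inter> Y \<times> Y"
  have GB[measurable]: "GB \<in> sets (M \<Otimes>\<^sub>M M)" and GY[measurable]: "GY \<in> sets (M \<Otimes>\<^sub>M M)"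
    unfolding GB_def GY_def by measurable
  have GsubF: "(x, y) \<in> F" if "(x, y) \<in> G" "x \<in> X" for x y
    using EF[OF that(2)] GE[OF that(2)] that(1) by blast
  have GBF: "GB \<subseteq> F" and GYF: "GY \<subseteq> F" using GsubF by (auto simp: GB_def GY_def B_def Y_def)

  define E' where "E' = E \<inter> Y \<times> Y"
  have E'[measurable]: "E' \<in> sets (M \<Otimes>\<^sub>M M)" unfolding E'_def by measurable
  have E'x: "E' `` {x} = E `` {x}" if "x \<in> Y" for x using Yclosed[OF that] that by (auto simp: E'_def)
  have outside: "2 * emeasure M Y \<le> (\<integral>\<^sup>+x. degree GY x \<partial>M)"
  proof (rule aperiodic_graphing_degree[OF _ E' _ _ _ GY])
    show "E' \<subseteq> F" using EF by (auto simp: E'_def Y_def)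
    show "equiv Y E'"
    proof (rule equivI)
      show "refl_on Y E'" using eqE Xsp by (auto simp: E'_def Y_def equiv_def refl_on_def)
      show "sym E'" "trans E'" using eqE unfolding E'_def equiv_def
        by (auto intro!: symI transI dest: symD transD)
    qed (auto simp: E'_def)
    show "infinite (E' `` {x})" if "x \<in> Y" for x
      using E'x[OF that] good[of x] that by (auto simp: Y_def)
    show "sym GY" using symG by (auto simp: GY_def sym_def)
    show "GY \<subseteq> Y \<times> Y" by (auto simp: GY_def)
    fix x assume x: "x \<in> Y"
    have xX: "x \<in> X" using x by (simp add: Y_def)
    have "GY\<^sup>* `` {x} \<subseteq> G\<^sup>* `` {x}" unfolding GY_def by (intro Image_mono rtrancl_mono) auto
    moreover have "G\<^sup>* `` {x} \<subseteq> GY\<^sup>* `` {x}"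
      unfolding GY_def using rtrancl_restrict[OF Y_closed _ x] by auto
    ultimately show "GY\<^sup>* `` {x} = E' `` {x}" using E'x[OF x] GE[OF xX] by blast
  qed simp

  \<comment> \<open>\<open>D\<close> is the graph of the map that sends a point of \<open>Y\<close> to the first of its translates in \<open>A\<close>;
    \<open>C n\<close> is the set where the translate has index \<open>n\<close>.\<close>
  define C where "C n = {x \<in> space M. x \<in> Y \<and> T n x \<in> A \<and> (\<forall>i<n. T i x \<notin> A)}" for n
  have [measurable]: "C n \<in> sets M" for n unfolding C_def by measurable
  define D where "D = (\<Union>n. (C n \<times> space M) \<inter> {p \<in> space (M \<Otimes>\<^sub>M M). T n (fst p) = snd p})"
  have [measurable]: "{p \<in> space (M \<Otimes>\<^sub>M M). T n (fst p) = snd p} \<in> sets (M \<Otimes>\<^sub>M M)" for n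
    by (intro equal_points_measurable) measurable
  have D[measurable]: "D \<in> sets (M \<Otimes>\<^sub>M M)" unfolding D_def by measurable
  have D_iff: "(x, y) \<in> D \<longleftrightarrow> (\<exists>n. x \<in> C n \<and> y = T n x)" for x y
    using T_space unfolding D_def by (auto simp: space_pair_measure C_def)
  have C_unique: "m = n" if "x \<in> C m" "x \<in> C n" for x m n
    using that by (cases m n rule: linorder_cases) (auto simp: C_def)
  have C_ex: "\<exists>n. x \<in> C n" if "x \<in> Y" for x
  proof -
    have ex: "\<exists>n. T n x \<in> A" using that good[of x] by (auto simp: Y_def)
    define n where "n = (LEAST n. T n x \<in> A)"
    have "T n x \<in> A" unfolding n_def by (rule LeastI_ex[OF ex])
    moreover have "T i x \<notin> A" if "i < n" for i
      using that unfolding n_def by (rule not_less_Least)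
    moreover have "x \<in> space M" using that Xsp by (simp add: Y_def)
    ultimately have "x \<in> C n" using that by (simp add: C_def)
    then show ?thesis by blast
  qed
  have DF: "D \<subseteq> F" by (auto simp: D_iff in_F_iff_T C_def)
  have D_YB: "x \<in> Y \<and> y \<in> B" if "(x, y) \<in> D" for x y
  proof -
    have "x \<in> Y" "y \<in> A" using that by (auto simp: D_iff C_def)
    moreover have "y \<in> X" using XF[of x y] that DF \<open>x \<in> Y\<close> by (auto simp: Y_def)
    ultimately show ?thesis by (simp add: B_def)
  qed
  have degD: "degree D x \<le> indicator Y x" for x
  proof (cases "x \<in> Y")
    case True
    then obtain n where n: "x \<in> C n" using C_ex by blast
    then have "D `` {x} \<subseteq> {T n x}" by (auto simp: D_iff dest: C_unique[OF _ n])
    then have "degree D x \<le> emeasure (count_space UNIV) {T n x}"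
      unfolding degree_def by (intro emeasure_mono) auto
    then show ?thesis using True by simp
  next
    case False
    then have "D `` {x} = {}" using D_YB by blast
    then show ?thesis by (simp add: degree_def)
  qed

  define H where "H = GB \<union> D \<union> D\<inverse>"
  have DcF: "D\<inverse> \<subseteq> F" using DF F_sym by auto
  have HF: "H \<subseteq> F" unfolding H_def using GBF DF DcF by blast
  have H_comp: "H\<^sup>* `` {x} = F `` {x}" if x: "x \<in> X" for x
  proof
    have "(x, y) \<in> F" if "(x, y) \<in> H\<^sup>*" for y
      using that
    proof induction
      case base
      show ?case by (rule F_refl[OF Xsp[OF x]])
    next
      case (step y z)
      have "(y, z) \<in> F" using step.hyps(2) HF by blast
      with step.IH show ?case by (rule F_trans)
    qed
    then show "H\<^sup>* `` {x} \<subseteq> F `` {x}" by blast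
    have to_B: "\<exists>u\<in>B. (z, u) \<in> H\<^sup>* \<and> (u, z) \<in> H\<^sup>* \<and> (z, u) \<in> F" if z: "z \<in> X" for z
    proof (cases "z \<in> A")
      case True
      then have "z \<in> B" using z by (simp add: B_def)
      then show ?thesis using F_refl[OF Xsp[OF z]] by blast
    next
      case False
      then have "z \<in> Y" using z by (simp add: Y_def)
      then obtain n where "z \<in> C n" using C_ex by blast
      then have zu: "(z, T n z) \<in> D" using D_iff by blast
      define u where "u = T n z"
      have "(z, u) \<in> H" "(u, z) \<in> H" using zu by (auto simp: H_def u_def)
      moreover have "u \<in> B" "(z, u) \<in> F" using D_YB[OF zu] zu DF by (auto simp: u_def)
      ultimately have "\<exists>u\<in>B. (z, u) \<in> H \<and> (u, z) \<in> H \<and> (z, u) \<in> F" by blast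
      then show ?thesis by blast
    qed
    show "F `` {x} \<subseteq> H\<^sup>* `` {x}"
    proof
      fix y assume "y \<in> F `` {x}"
      then have xy: "(x, y) \<in> F" by simp
      obtain u where u: "u \<in> B" "(x, u) \<in> H\<^sup>*" "(x, u) \<in> F" using to_B[OF x] by blast
      obtain v where v: "v \<in> B" "(v, y) \<in> H\<^sup>*" "(y, v) \<in> F" using to_B[OF XF[OF x xy]] by blast
      have "(u, v) \<in> F" by (rule F_trans[OF F_sym[OF u(3)] F_trans[OF xy v(3)]])
      then have "(u, v) \<in> E" using u v good[of u] by (auto simp: B_def)
      then have "(u, v) \<in> G\<^sup>*" using GE[of u] u by (auto simp: B_def)
      then have "(u, v) \<in> GB\<^sup>*"
        unfolding GB_def using rtrancl_restrict[OF B_closed _ u(1)] by blast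
      then have "(u, v) \<in> H\<^sup>*" using rtrancl_mono[of GB H] by (auto simp: H_def)
      then have "(x, y) \<in> H\<^sup>*" using u(2) v(2) by (meson rtrancl_trans)
      then show "y \<in> H\<^sup>* `` {x}" by simp
    qed
  qed
  have "graphing M F H"
    unfolding graphing_def
  proof (intro conjI)
    have [measurable]: "D\<inverse> \<in> sets (M \<Otimes>\<^sub>M M)" by (rule converse_measurable[OF D])
    show "H \<in> sets (M \<Otimes>\<^sub>M M)" unfolding H_def by measurable
    show "sym H" using symG by (auto simp: H_def GB_def sym_def)
    have "(x, x) \<notin> D" for x using D_YB[of x x] by (auto simp: B_def Y_def)
    then show "irrefl H" using irrG by (auto simp: H_def GB_def irrefl_def)
    show "AE x in M. H\<^sup>* `` {x} = F `` {x}" using X_ae by eventually_elim (rule H_comp)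
  qed
  moreover have "(\<integral>\<^sup>+x. degree H x \<partial>M) \<le> (\<integral>\<^sup>+x. degree G x \<partial>M)"
  proof -
    note [measurable] = degree_measurable[OF GB GBF] degree_measurable[OF GY GYF]
      degree_measurable[OF D DF] degree_measurable[OF converse_measurable[OF D] DcF]
    have "(\<integral>\<^sup>+x. degree H x \<partial>M) \<le> (\<integral>\<^sup>+x. degree GB x + degree D x + degree (D\<inverse>) x \<partial>M)"
      unfolding H_def
      by (intro nn_integral_mono order_trans[OF degree_Un_le] add_right_mono degree_Un_le)
    also have "\<dots> = (\<integral>\<^sup>+x. degree GB x \<partial>M) + 2 * (\<integral>\<^sup>+x. degree D x \<partial>M)"
      by (simp add: nn_integral_add mass_transport[OF D DF] mult_2 add.assoc)
    also have "\<dots> \<le> (\<integral>\<^sup>+x. degree GB x \<partial>M) + 2 * (\<integral>\<^sup>+x. indicator Y x \<partial>M)"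
      by (intro add_left_mono mult_left_mono nn_integral_mono degD) simp
    also have "\<dots> \<le> (\<integral>\<^sup>+x. degree GB x \<partial>M) + (\<integral>\<^sup>+x. degree GY x \<partial>M)"
      using outside by (intro add_left_mono) simp
    also have "\<dots> = (\<integral>\<^sup>+x. degree GB x + degree GY x \<partial>M)"
      by (rule nn_integral_add[symmetric]) measurable
    also have "\<dots> \<le> (\<integral>\<^sup>+x. degree G x \<partial>M)"
    proof (intro nn_integral_mono)
      fix x
      show "degree GB x + degree GY x \<le> degree G x"
      proof (cases "x \<in> B")
        case True
        then have "GY `` {x} = {}" by (auto simp: GY_def B_def Y_def)
        then have "degree GY x = 0" by (simp add: degree_def)
        then show ?thesis using degree_mono[of GB G x] by (auto simp: GB_def)
      next
        case False
        then have "GB `` {x} = {}" by (auto simp: GB_def)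
        then have "degree GB x = 0" by (simp add: degree_def)
        then show ?thesis using degree_mono[of GY G x] by (auto simp: GY_def)
      qed
    qed
    finally show ?thesis .
  qed
  ultimately show "cost M F \<le> (\<integral>\<^sup>+x. degree G x \<partial>M) / 2"
    unfolding cost_def by (intro INF_lower2[of H]) (auto intro: divide_right_mono_ennreal)
qed

end

section \<open>Almost invariant averages of class-valued maps\<close>

text \<open>Put mass \<open>w i\<close> on the class of \<open>p i\<close>. The right-hand side is the sum of the squares of the total masses of all
classes, the left-hand side the single square belonging to the class of \<open>y\<close>.\<close>

lemma equiv_sum_square_le:
  fixes w :: "'i \<Rightarrow> real"
  assumes eq: "equiv X E" and fin: "finite I" and p: "\<And>i. i \<in> I \<Longrightarrow> p i \<in> X" and y: "y \<in> X"
  shows "(\<Sum>i\<in>I. w i * indicator E (p i, y))\<^sup>2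
    \<le> (\<Sum>i\<in>I. w i * (\<Sum>j\<in>I. w j * indicator E (p j, p i)))"
proof -
  define c where "c i = E `` {p i}" for i
  define s where "s C = (\<Sum>j\<in>I. w j * of_bool (c j = C))" for C
  have s: "(\<Sum>j\<in>I. w j * indicator E (p j, z)) = s (E `` {z})" if "z \<in> X" for z
    unfolding s_def c_def
    by (intro sum.cong refl) (simp add: indicator_def eq_equiv_class_iff[OF eq p that])
  have "(\<Sum>i\<in>I. w i * (\<Sum>j\<in>I. w j * indicator E (p j, p i))) = (\<Sum>i\<in>I. w i * s (c i))"
    by (intro sum.cong refl) (simp add: s p c_def)
  also have "\<dots> = (\<Sum>C\<in>c ` I. \<Sum>i | i \<in> I \<and> c i = C. w i * s (c i))"
    by (rule sum.image_gen[OF fin])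
  also have "\<dots> = (\<Sum>C\<in>c ` I. (s C)\<^sup>2)"
  proof (intro sum.cong refl)
    fix C
    have "(\<Sum>i | i \<in> I \<and> c i = C. w i * s (c i)) = (\<Sum>i | i \<in> I \<and> c i = C. w i) * s C"
      by (simp add: sum_distrib_right)
    also have "(\<Sum>i | i \<in> I \<and> c i = C. w i) = s C"
      unfolding s_def by (rule sum.mono_neutral_cong_left) (use fin in auto)
    finally show "(\<Sum>i | i \<in> I \<and> c i = C. w i * s (c i)) = (s C)\<^sup>2"
      by (simp add: power2_eq_square)
  qed
  finally have rhs: "(\<Sum>i\<in>I. w i * (\<Sum>j\<in>I. w j * indicator E (p j, p i))) = (\<Sum>C\<in>c ` I. (s C)\<^sup>2)" .
  have "(s (E `` {y}))\<^sup>2 \<le> (\<Sum>C\<in>c ` I. (s C)\<^sup>2)"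
  proof (cases "E `` {y} \<in> c ` I")
    case True
    then show ?thesis using fin by (intro member_le_sum) auto
  next
    case False
    then have "s (E `` {y}) = 0" unfolding s_def by (intro sum.neutral) auto
    then show ?thesis by (simp add: sum_nonneg)
  qed
  then show ?thesis using rhs s[OF y] by simp
qed

text \<open>The second moments decrease so fast that first moments are summable, by
\<open>\<bar>u\<bar> \<le> 2\<^sup>-\<^sup>n + 2\<^sup>n u\<^sup>2\<close>.\<close>

lemma (in prob_space) AE_summable_of_second_moments:
  fixes u :: "nat \<Rightarrow> 'a \<Rightarrow> real"
  assumes [measurable]: "\<And>n. u n \<in> borel_measurable M"
    and bound: "\<And>n. (\<integral>\<^sup>+x. ennreal ((u n x)\<^sup>2) \<partial>M) \<le> ennreal (4 * (1/8)^n)"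
  shows "AE x in M. summable (\<lambda>n. u n x)"
proof -
  have first: "(\<integral>\<^sup>+x. ennreal \<bar>u n x\<bar> \<partial>M) \<le> ennreal (5 * (1/2)^n)" for n
  proof -
    have pt: "ennreal \<bar>u n x\<bar> \<le> ennreal ((1/2)^n) + ennreal (2^n) * ennreal ((u n x)\<^sup>2)" for x
    proof -
      have "\<bar>u n x\<bar> \<le> (1/2)^n + 2^n * (u n x)\<^sup>2"
      proof (cases "\<bar>u n x\<bar> \<le> (1/2)^n")
        case True
        then show ?thesis by (simp add: add_increasing2)
      next
        case False
        then have "1 \<le> 2^n * \<bar>u n x\<bar>" by (simp add: power_one_over field_simps)
        then have "1 * \<bar>u n x\<bar> \<le> (2^n * \<bar>u n x\<bar>) * \<bar>u n x\<bar>" by (rule mult_right_mono) simp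
        then show ?thesis by (simp add: power2_eq_square add_increasing)
      qed
      then show ?thesis by (simp add: ennreal_mult[symmetric] ennreal_plus[symmetric] ennreal_leI del: ennreal_plus)
    qed
    have "(\<integral>\<^sup>+x. ennreal \<bar>u n x\<bar> \<partial>M)
        \<le> (\<integral>\<^sup>+x. ennreal ((1/2)^n) + ennreal (2^n) * ennreal ((u n x)\<^sup>2) \<partial>M)"
      by (intro nn_integral_mono pt)
    also have "\<dots> = ennreal ((1/2)^n) + ennreal (2^n) * (\<integral>\<^sup>+x. ennreal ((u n x)\<^sup>2) \<partial>M)"
      by (simp add: nn_integral_add nn_integral_cmult emeasure_space_1)
    also have "\<dots> \<le> ennreal ((1/2)^n) + ennreal (2^n) * ennreal (4 * (1/8)^n)"
      by (intro add_left_mono mult_left_mono bound) simp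
    also have "\<dots> = ennreal ((1/2)^n + 2^n * (4 * (1/8)^n))"
      by (simp add: ennreal_mult[symmetric] ennreal_plus[symmetric] del: ennreal_plus)
    also have "\<dots> \<le> ennreal (5 * (1/2)^n)"
    proof (rule ennreal_leI)
      have "(2::real)^n * (4 * (1/8)^n) = 4 * (1/4)^n"
        by (simp add: power_mult_distrib[symmetric])
      moreover have "(1/4::real)^n \<le> (1/2)^n" by (intro power_mono) auto
      ultimately show "(1/2::real)^n + 2^n * (4 * (1/8)^n) \<le> 5 * (1/2)^n" by linarith
    qed
    finally show ?thesis .
  qed
  have "(\<integral>\<^sup>+x. (\<Sum>n. ennreal \<bar>u n x\<bar>) \<partial>M) = (\<Sum>n. \<integral>\<^sup>+x. ennreal \<bar>u n x\<bar> \<partial>M)"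
    by (rule nn_integral_suminf) measurable
  also have "\<dots> \<le> (\<Sum>n. ennreal (5 * (1/2)^n))"
    by (intro suminf_le first) auto
  also have "\<dots> = ennreal (\<Sum>n. 5 * (1/2)^n)"
    by (intro suminf_ennreal2 summable_mult summable_geometric) auto
  also have "\<dots> < \<infinity>" by simp
  finally have "(\<integral>\<^sup>+x. (\<Sum>n. ennreal \<bar>u n x\<bar>) \<partial>M) \<noteq> \<infinity>" by simp
  then have "AE x in M. (\<Sum>n. ennreal \<bar>u n x\<bar>) \<noteq> \<infinity>"
    by (intro nn_integral_PInf_AE) measurable
  then show ?thesis
  proof eventually_elim
    case (elim x)
    then have "summable (\<lambda>n. \<bar>u n x\<bar>)" by (intro summable_suminf_not_top) auto
    then show ?case by (rule summable_rabs_cancel)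
  qed
qed

locale class_valued_map = pmp_action \<Gamma> M a
  for \<Gamma> :: "('g, 'm) monoid_scheme" and M :: "'x measure" and a :: "'g \<Rightarrow> 'x \<Rightarrow> 'x" +
  fixes E :: "('x \<times> 'x) set" and S :: "'x \<Rightarrow> 'x"
  assumes E_measurable: "E \<in> sets (M \<Otimes>\<^sub>M M)"
    and E_equiv: "equiv (space M) E"
    and S_measurable[measurable]: "S \<in> M \<rightarrow>\<^sub>M M"
begin

text \<open>A list of pairs \<open>(w, g)\<close> stands for the formal combination of the class-valued maps
\<open>x \<mapsto> [S (g \<cdot> x)]\<close> with coefficients \<open>w\<close>, that is, for a vector field \<open>x \<mapsto> f x\<close> with \<open>f x\<close> in
\<open>\<ell>\<^sup>2([x]\<^sub>F / E)\<close>. The coordinate of \<open>f x\<close> at the class of \<open>y\<close> is \<open>class_weight l x y\<close>, and \<open>pairing\<close> is the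
pointwise inner product of two vector fields. With lists, addition is concatenation, and \<open>shift h\<close> realizes the action
of \<open>h\<close> on vector fields.\<close>

definition class_weight :: "(real \<times> 'g) list \<Rightarrow> 'x \<Rightarrow> 'x \<Rightarrow> real" where
  "class_weight l x y = (\<Sum>(w, g)\<leftarrow>l. w * indicator E (S (a g x), y))"

definition pairing :: "(real \<times> 'g) list \<Rightarrow> (real \<times> 'g) list \<Rightarrow> 'x \<Rightarrow> real" where
  "pairing l m x = (\<Sum>(w, g)\<leftarrow>l. w * class_weight m x (S (a g x)))"

definition scale :: "real \<Rightarrow> (real \<times> 'g) list \<Rightarrow> (real \<times> 'g) list" where
  "scale r = map (\<lambda>(w, g). (r * w, g))"

definition shift :: "'g \<Rightarrow> (real \<times> 'g) list \<Rightarrow> (real \<times> 'g) list" where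
  "shift h = map (\<lambda>(w, g). (w, g \<otimes>\<^bsub>\<Gamma>\<^esub> h))"

definition combination :: "(real \<times> 'g) list \<Rightarrow> bool" where
  "combination l \<longleftrightarrow> snd ` set l \<subseteq> carrier \<Gamma>"

definition convex_combination :: "(real \<times> 'g) list \<Rightarrow> bool" where
  "convex_combination l \<longleftrightarrow> combination l \<and> (\<forall>w\<in>fst ` set l. 0 \<le> w) \<and> sum_list (map fst l) = 1"

definition energy :: "(real \<times> 'g) list \<Rightarrow> real" where
  "energy l = (\<integral>x. pairing l l x \<partial>M)"

lemma combination_Nil[simp]: "combination []"
  and combination_Cons[simp]: "combination ((w, g) # l) \<longleftrightarrow> g \<in> carrier \<Gamma> \<and> combination l"
  and combination_append[simp]: "combination (l @ m) \<longleftrightarrow> combination l \<and> combination m"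
  and combination_scale[simp]: "combination (scale r l) \<longleftrightarrow> combination l"
  by (auto simp: combination_def scale_def image_image case_prod_beta)

lemma shift_Nil[simp]: "shift h [] = []"
  and shift_Cons[simp]: "shift h ((w, g) # l) = (w, g \<otimes>\<^bsub>\<Gamma>\<^esub> h) # shift h l"
  by (simp_all add: shift_def)

lemma combination_shift: "h \<in> carrier \<Gamma> \<Longrightarrow> combination l \<Longrightarrow> combination (shift h l)"
  by (auto simp: combination_def shift_def)

lemma S_act_space: "g \<in> carrier \<Gamma> \<Longrightarrow> x \<in> space M \<Longrightarrow> S (a g x) \<in> space M"
  using measurable_space[OF S_measurable] act_space by blast

lemma class_weight_append: "class_weight (l @ m) x y = class_weight l x y + class_weight m x y"
  by (simp add: class_weight_def)

lemma class_weight_scale: "class_weight (scale r l) x y = r * class_weight l x y"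
  by (induction l) (auto simp: class_weight_def scale_def algebra_simps)

lemma class_weight_shift:
  assumes "h \<in> carrier \<Gamma>" "x \<in> space M" "combination l"
  shows "class_weight (shift h l) x y = class_weight l (a h x) y"
  using assms(3)
  by (induction l) (auto simp: class_weight_def act_mult assms)

lemma pairing_append_left: "pairing (l @ l') m x = pairing l m x + pairing l' m x"
  by (simp add: pairing_def)

lemma pairing_append_right: "pairing l (m @ m') x = pairing l m x + pairing l m' x"
  by (induction l) (auto simp: pairing_def class_weight_append algebra_simps)

lemma pairing_scale_left: "pairing (scale r l) m x = r * pairing l m x"
  by (induction l) (auto simp: pairing_def scale_def algebra_simps)

lemma pairing_scale_right: "pairing l (scale r m) x = r * pairing l m x"
  by (induction l) (auto simp: pairing_def class_weight_scale algebra_simps)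

lemma pairing_shift:
  assumes h: "h \<in> carrier \<Gamma>" and x: "x \<in> space M" and "combination l" and m: "combination m"
  shows "pairing (shift h l) (shift h m) x = pairing l m (a h x)"
  using assms(3)
proof (induction l)
  case (Cons wg l)
  then show ?case
    by (cases wg) (simp add: pairing_def class_weight_shift[OF h x m] act_mult h x)
qed (simp add: pairing_def)

text \<open>The parallelogram law: on expanding by bilinearity, the mixed terms cancel.\<close>

lemma parallelogram:
  "pairing (l @ scale (-1) m) (l @ scale (-1) m) x
     + 4 * pairing (scale (1/2) l @ scale (1/2) m) (scale (1/2) l @ scale (1/2) m) x
   = 2 * pairing l l x + 2 * pairing m m x"
  by (simp add: pairing_append_left pairing_append_right pairing_scale_left pairing_scale_right
      field_simps)

lemma class_weight_square_le_pairing: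
  assumes "combination l" "x \<in> space M" "y \<in> space M"
  shows "(class_weight l x y)\<^sup>2 \<le> pairing l l x"
proof -
  let ?w = "\<lambda>i. fst (l ! i)" and ?p = "\<lambda>i. S (a (snd (l ! i)) x)"
  have "class_weight l x z = (\<Sum>i\<in>{0..<length l}. ?w i * indicator E (?p i, z))" for z
    by (simp add: class_weight_def sum_list_sum_nth case_prod_beta)
  moreover have "pairing l l x = (\<Sum>i\<in>{0..<length l}. ?w i * class_weight l x (?p i))"
    by (simp add: pairing_def sum_list_sum_nth case_prod_beta)
  moreover have "?p i \<in> space M" if "i \<in> {0..<length l}" for i
    using assms that by (intro S_act_space) (auto simp: combination_def)
  ultimately show ?thesis
    using equiv_sum_square_le[OF E_equiv, of "{0..<length l}" ?p y ?w] assms(3) by simp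
qed

lemma class_weight_measurable:
  assumes "combination l" and [measurable]: "f \<in> M \<rightarrow>\<^sub>M M" "g \<in> M \<rightarrow>\<^sub>M M"
  shows "(\<lambda>x. class_weight l (f x) (g x)) \<in> borel_measurable M"
  using assms(1)
proof (induction l)
  case (Cons wh l)
  obtain w h where wh: "wh = (w, h)" by (cases wh)
  have [measurable]: "a h \<in> M \<rightarrow>\<^sub>M M" using Cons.prems wh act_measurable by simp
  have [measurable]: "E \<in> sets (M \<Otimes>\<^sub>M M)" by (rule E_measurable)
  have [measurable]: "(\<lambda>x. class_weight l (f x) (g x)) \<in> borel_measurable M" using Cons wh by simp
  have "(\<lambda>x. w * indicator E (S (a h (f x)), g x) + class_weight l (f x) (g x)) \<in> borel_measurable M"
    by measurable
  then show ?case by (simp add: class_weight_def wh)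
qed (simp add: class_weight_def)

lemma pairing_measurable:
  assumes "combination l" "combination m"
  shows "pairing l m \<in> borel_measurable M"
  using assms(1)
proof (induction l)
  case (Cons wh l)
  obtain w h where wh: "wh = (w, h)" by (cases wh)
  have [measurable]: "a h \<in> M \<rightarrow>\<^sub>M M" using Cons.prems wh act_measurable by simp
  have [measurable]: "(\<lambda>x. class_weight m x (S (a h x))) \<in> borel_measurable M"
    by (intro class_weight_measurable assms) measurable
  have [measurable]: "pairing l m \<in> borel_measurable M" using Cons wh by simp
  have "(\<lambda>x. w * class_weight m x (S (a h x)) + pairing l m x) \<in> borel_measurable M"
    by measurable
  then show ?case by (simp add: pairing_def wh)
qed (simp add: pairing_def[abs_def])

lemma abs_class_weight_le: "\<bar>class_weight l x y\<bar> \<le> (\<Sum>(w, g)\<leftarrow>l. \<bar>w\<bar>)"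
proof (induction l)
  case (Cons wh l)
  obtain w h where wh: "wh = (w, h)" by (cases wh)
  have "\<bar>w * indicator E (S (a h x), y) + class_weight l x y\<bar> \<le> \<bar>w\<bar> + \<bar>class_weight l x y\<bar>"
    by (auto simp: indicator_def)
  then show ?case using Cons by (simp add: class_weight_def wh)
qed (simp add: class_weight_def)

lemma abs_pairing_le: "\<bar>pairing l m x\<bar> \<le> (\<Sum>(w, g)\<leftarrow>l. \<bar>w\<bar>) * (\<Sum>(w, g)\<leftarrow>m. \<bar>w\<bar>)"
proof (induction l)
  case (Cons wh l)
  obtain w h where wh: "wh = (w, h)" by (cases wh)
  have "\<bar>w * class_weight m x (S (a h x)) + pairing l m x\<bar> \<le> \<bar>w\<bar> * \<bar>class_weight m x (S (a h x))\<bar> + \<bar>pairing l m x\<bar>"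
    by (metis abs_mult abs_triangle_ineq)
  also have "\<dots> \<le> \<bar>w\<bar> * (\<Sum>(w, g)\<leftarrow>m. \<bar>w\<bar>) + \<bar>pairing l m x\<bar>"
    by (intro add_right_mono mult_left_mono abs_class_weight_le) simp
  finally show ?case using Cons by (simp add: pairing_def wh distrib_right)
qed (simp add: pairing_def)

lemma pairing_integrable:
  assumes "combination l" "combination m"
  shows "integrable M (pairing l m)"
  using abs_pairing_le[of l m] by (intro integrable_const_bound pairing_measurable assms) auto

lemma energy_nonneg: "combination l \<Longrightarrow> 0 \<le> energy l"
  unfolding energy_def
  by (intro Bochner_Integration.integral_nonneg)
    (meson order_trans class_weight_square_le_pairing zero_le_power2)

lemma energy_shift:
  assumes h: "h \<in> carrier \<Gamma>" and l: "combination l"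
  shows "energy (shift h l) = energy l"
proof -
  have "energy (shift h l) = (\<integral>x. pairing l l (a h x) \<partial>M)"
    unfolding energy_def by (intro Bochner_Integration.integral_cong refl pairing_shift assms)
  also have "\<dots> = (\<integral>x. pairing l l x \<partial>distr M M (a h))"
    by (rule integral_distr[symmetric]) (intro act_measurable pairing_measurable assms)+
  finally show ?thesis using distr_act[OF h] by (simp add: energy_def)
qed

lemma energy_parallelogram:
  assumes "combination l" "combination m"
  shows "energy (l @ scale (-1) m) + 4 * energy (scale (1/2) l @ scale (1/2) m)
    = 2 * energy l + 2 * energy m"
proof -
  let ?d = "l @ scale (-1) m" and ?s = "scale (1/2) l @ scale (1/2) m"
  have "energy ?d + 4 * energy ?s = (\<integral>x. pairing ?d ?d x + 4 * pairing ?s ?s x \<partial>M)"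
    unfolding energy_def using assms
    by (subst Bochner_Integration.integral_add) (auto intro!: pairing_integrable)
  also have "\<dots> = (\<integral>x. 2 * pairing l l x + 2 * pairing m m x \<partial>M)"
    by (simp only: parallelogram)
  also have "\<dots> = 2 * energy l + 2 * energy m"
    unfolding energy_def using assms
    by (subst Bochner_Integration.integral_add) (auto intro!: pairing_integrable)
  finally show ?thesis .
qed

text \<open>The midpoint of two convex combinations is convex, so its energy is at least \<open>q\<close>, and the parallelogram law forces two
almost minimal combinations to be close in norm. The norm at \<open>x\<close> dominates the coordinate at the class of \<open>x\<close>.\<close>

lemma second_moment_difference_le:
  assumes q: "\<And>l. convex_combination l \<Longrightarrow> q \<le> energy l"
    and l: "convex_combination l" "energy l \<le> q + \<epsilon>"
    and m: "convex_combination m" "energy m \<le> q + \<epsilon>"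
  shows "(\<integral>\<^sup>+x. ennreal ((class_weight l x x - class_weight m x x)\<^sup>2) \<partial>M) \<le> ennreal (4 * \<epsilon>)"
proof -
  let ?d = "l @ scale (-1) m" and ?s = "scale (1/2) l @ scale (1/2) m"
  have comb: "combination l" "combination m" using l m by (auto simp: convex_combination_def)
  have "sum_list (map fst (scale r k)) = r * sum_list (map fst k)" for r k
    by (induction k) (auto simp: scale_def algebra_simps)
  then have "convex_combination ?s"
    using l m by (auto simp: convex_combination_def) (auto simp: scale_def)
  then have "energy ?d \<le> 4 * \<epsilon>"
    using energy_parallelogram[OF comb] q[of ?s] l m by linarith
  have "(\<integral>\<^sup>+x. ennreal ((class_weight l x x - class_weight m x x)\<^sup>2) \<partial>M) \<le> (\<integral>\<^sup>+x. ennreal (pairing ?d ?d x) \<partial>M)"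
  proof (intro nn_integral_mono ennreal_leI)
    fix x assume "x \<in> space M"
    then show "(class_weight l x x - class_weight m x x)\<^sup>2 \<le> pairing ?d ?d x"
      using class_weight_square_le_pairing[of ?d x x] comb by (simp add: class_weight_append class_weight_scale)
  qed
  also have "\<dots> = ennreal (energy ?d)"
    unfolding energy_def using comb
    by (intro nn_integral_eq_integral pairing_integrable AE_I2)
      (auto intro: order_trans[OF zero_le_power2 class_weight_square_le_pairing])
  also have "\<dots> \<le> ennreal (4 * \<epsilon>)" by (rule ennreal_leI) fact
  finally show ?thesis .
qed

text \<open>The almost minimal combinations form a Cauchy sequence. Shifting one of them gives another combination of the same energy,
which is therefore close to it, so the limit is invariant.\<close>

lemma asymptotically_invariant_combinations:
  obtains l where "\<And>n. convex_combination (l n)"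
    and "AE x in M. convergent (\<lambda>n. class_weight (l n) x x)"
    and "AE x in M. \<forall>h\<in>carrier \<Gamma>. (\<lambda>n. class_weight (l n) (a h x) x - class_weight (l n) x x) \<longlonglongrightarrow> 0"
proof -
  define q where "q = (INF l\<in>Collect convex_combination. energy l)"
  have bdd: "bdd_below (energy ` Collect convex_combination)"
    using energy_nonneg by (intro bdd_belowI[of _ 0]) (auto simp: convex_combination_def)
  have q: "q \<le> energy l" if "convex_combination l" for l
    unfolding q_def using that by (intro cINF_lower[OF bdd]) simp
  have "convex_combination [(1, \<one>\<^bsub>\<Gamma>\<^esub>)]" by (simp add: convex_combination_def)
  then have ne: "Collect convex_combination \<noteq> {}" by blast
  \<comment> \<open>Any rate would give convergence in norm; this one makes the differences of consecutive terms
    absolutely summable almost everywhere.\<close>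
  have "\<exists>l. convex_combination l \<and> energy l \<le> q + (1/8)^n" for n
  proof -
    have "q < q + (1/8)^n" by simp
    then obtain l where "convex_combination l" "energy l < q + (1/8)^n"
      using cINF_less_iff[OF ne bdd, of "q + (1/8)^n"] unfolding q_def[symmetric] by blast
    then show ?thesis using less_imp_le by blast
  qed
  then obtain l where l: "\<And>n. convex_combination (l n)" and le: "\<And>n. energy (l n) \<le> q + (1/8)^n"
    by metis
  have comb: "combination (l n)" for n using l by (simp add: convex_combination_def)
  have [measurable]: "(\<lambda>x. class_weight (l n) x x) \<in> borel_measurable M" for n
    by (intro class_weight_measurable comb) measurable
  have "energy (l (Suc n)) \<le> q + (1/8)^n" for n
    using le[of "Suc n"] power_decreasing[of n "Suc n" "1/8::real"] by linarith
  then have "AE x in M. summable (\<lambda>n. class_weight (l (Suc n)) x x - class_weight (l n) x x)"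
    by (intro AE_summable_of_second_moments second_moment_difference_le[OF q] l le) measurable
  then have conv: "AE x in M. convergent (\<lambda>n. class_weight (l n) x x)"
  proof eventually_elim
    case (elim x)
    then have "(\<lambda>n. \<Sum>k<n. class_weight (l (Suc k)) x x - class_weight (l k) x x) \<longlonglongrightarrow> (\<Sum>k. class_weight (l (Suc k)) x x - class_weight (l k) x x)"
      by (rule summable_LIMSEQ)
    then have "(\<lambda>n. class_weight (l n) x x - class_weight (l 0) x x) \<longlonglongrightarrow> (\<Sum>k. class_weight (l (Suc k)) x x - class_weight (l k) x x)"
      by (simp only: sum_lessThan_telescope[of "\<lambda>n. class_weight (l n) x x"])
    from tendsto_add[OF this tendsto_const[of "class_weight (l 0) x x"]]
    show ?case by (auto simp: convergent_def)
  qed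
  have inv: "AE x in M. \<forall>h\<in>carrier \<Gamma>. (\<lambda>n. class_weight (l n) (a h x) x - class_weight (l n) x x) \<longlonglongrightarrow> 0"
  proof (rule AE_ball_countable')
    fix h assume h: "h \<in> carrier \<Gamma>"
    have sh: "convex_combination (shift h (l n))" for n
    proof -
      have "map fst (shift h (l n)) = map fst (l n)" by (auto simp: shift_def)
      moreover from this have "fst ` set (shift h (l n)) = fst ` set (l n)"
        by (metis list.set_map)
      ultimately show ?thesis
        using l[of n] combination_shift[OF h] by (simp add: convex_combination_def)
    qed
    have [measurable]: "(\<lambda>x. class_weight (shift h (l n)) x x) \<in> borel_measurable M" for n
      using sh by (intro class_weight_measurable) (auto simp: convex_combination_def)
    have "AE x in M. summable (\<lambda>n. class_weight (shift h (l n)) x x - class_weight (l n) x x)"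
      using energy_shift[OF h comb] le
      by (intro AE_summable_of_second_moments second_moment_difference_le[OF q] l le sh) auto
    then show "AE x in M. (\<lambda>n. class_weight (l n) (a h x) x - class_weight (l n) x x) \<longlonglongrightarrow> 0"
      using AE_space
    proof eventually_elim
      case (elim x)
      then show ?case using summable_LIMSEQ_zero[OF elim(1)] by (simp add: class_weight_shift[OF h _ comb])
    qed
  qed (rule countable_group)
  show ?thesis using that l conv inv by blast
qed

lemma class_weight_bounds:
  assumes "convex_combination l"
  shows "0 \<le> class_weight l x y" "class_weight l x y \<le> 1"
proof -
  have nn: "0 \<le> class_weight k x y" if "\<forall>w\<in>fst ` set k. 0 \<le> w" for k
    using that by (induction k) (auto simp: class_weight_def)
  have le: "class_weight k x y \<le> sum_list (map fst k)" if "\<forall>w\<in>fst ` set k. 0 \<le> w" for k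
    using that by (induction k) (auto simp: class_weight_def indicator_def)
  from nn[of l] le[of l] show "0 \<le> class_weight l x y" "class_weight l x y \<le> 1"
    using assms by (auto simp: convex_combination_def)
qed

lemma class_weight_cong:
  assumes "(y, z) \<in> E"
  shows "class_weight l x y = class_weight l x z"
proof -
  have "indicator E (p, y) = (indicator E (p, z) :: real)" for p
    using assms E_equiv by (auto simp: indicator_def equiv_def dest: symD transD)
  then show ?thesis by (simp add: class_weight_def)
qed

text \<open>Inequivalent points lie in different classes, and the weights of all classes add up to 1.\<close>

lemma class_weight_sum_le_1:
  assumes "convex_combination l" "(y, z) \<notin> E"
  shows "class_weight l x y + class_weight l x z \<le> 1"
proof -
  have "\<not> ((p, y) \<in> E \<and> (p, z) \<in> E)" for p
    using assms(2) E_equiv unfolding equiv_def by (meson symD transD)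
  then have disj: "indicator E (p, y) + indicator E (p, z) \<le> (1::real)" for p
    by (auto simp: indicator_def)
  have "class_weight k x y + class_weight k x z \<le> sum_list (map fst k)" if "\<forall>w\<in>fst ` set k. 0 \<le> w" for k
    using that
  proof (induction k)
    case (Cons wg k)
    obtain w g where wg: "wg = (w, g)" by (cases wg)
    let ?p = "S (a g x)"
    have "w * (indicator E (?p, y) + indicator E (?p, z)) \<le> w * 1"
      using Cons.prems wg by (intro mult_left_mono disj) auto
    then have "w * indicator E (?p, y) + w * indicator E (?p, z) \<le> w"
      by (simp add: distrib_left)
    with Cons show ?case by (auto simp: class_weight_def wg)
  qed (simp add: class_weight_def)
  from this[of l] show ?thesis using assms(1) by (auto simp: convex_combination_def)
qed

lemma integral_class_weight:
  assumes "combination l" and [measurable]: "S' \<in> M \<rightarrow>\<^sub>M M"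
  shows "(\<integral>x. class_weight l (S' x) x \<partial>M) = (\<Sum>(w, g)\<leftarrow>l. w * phi M E (S \<circ> a g \<circ> S'))"
  using assms(1)
proof (induction l)
  case (Cons wh l)
  obtain w h where wh: "wh = (w, h)" by (cases wh)
  have h: "h \<in> carrier \<Gamma>" and l: "combination l" using Cons.prems wh by auto
  have [measurable]: "a h \<in> M \<rightarrow>\<^sub>M M" using h act_measurable by simp
  let ?B = "{x \<in> space M. (S (a h (S' x)), x) \<in> E}"
  have B[measurable]: "?B \<in> sets M" by (intro pair_measurable E_measurable) measurable
  have "(\<integral>x. class_weight (wh # l) (S' x) x \<partial>M) = (\<integral>x. w * indicator ?B x + class_weight l (S' x) x \<partial>M)"
    by (intro Bochner_Integration.integral_cong) (auto simp: class_weight_def wh indicator_def)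
  also have "\<dots> = w * measure M ?B + (\<integral>x. class_weight l (S' x) x \<partial>M)"
  proof (subst Bochner_Integration.integral_add)
    show "integrable M (\<lambda>x. class_weight l (S' x) x)"
      using abs_class_weight_le[of l] by (intro integrable_const_bound class_weight_measurable l) auto
  qed (auto simp: less_top[symmetric])
  finally show ?case using Cons.IH l by (simp add: wh phi_def)
qed (simp add: class_weight_def)

text \<open>The limiting weight \<open>h\<close> of the class of a point depends neither on the base point in the \<open>F\<close>-class nor on the
representative of the \<open>E\<close>-class. Two \<open>E\<close>-classes of an \<open>F\<close>-class cannot both have weight more than \<open>1/2\<close>, and
evaluating at the base point \<open>S' x\<close> shows that the mean of \<open>h\<close> is at least \<open>c\<close>.\<close>

theorem common_class_on_positive_set:
  assumes sub: "AE x in M. E `` {x} \<subseteq> F `` {x}"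
    and S'[measurable]: "S' \<in> M \<rightarrow>\<^sub>M M" and S'F: "AE x in M. (S' x, x) \<in> F"
    and c: "1 / 2 < c" "\<And>g. g \<in> carrier \<Gamma> \<Longrightarrow> c \<le> phi M E (S \<circ> a g \<circ> S')"
  obtains A where "A \<in> sets M" "0 < measure M A"
    "AE x in M. \<forall>y. (x, y) \<in> E \<longrightarrow> (x \<in> A \<longleftrightarrow> y \<in> A)"
    "AE x in M. x \<in> A \<longrightarrow> (\<forall>y. (x, y) \<in> F \<longrightarrow> y \<in> A \<longrightarrow> (x, y) \<in> E)"
proof -
  obtain l where l: "\<And>n. convex_combination (l n)"
    and conv: "AE x in M. convergent (\<lambda>n. class_weight (l n) x x)"
    and inv: "AE x in M. \<forall>h\<in>carrier \<Gamma>. (\<lambda>n. class_weight (l n) (a h x) x - class_weight (l n) x x) \<longlonglongrightarrow> 0"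
    by (rule asymptotically_invariant_combinations, rule that)
  have comb: "combination (l n)" for n using l by (simp add: convex_combination_def)
  have [measurable]: "(\<lambda>x. class_weight (l n) x x) \<in> borel_measurable M" "(\<lambda>x. class_weight (l n) (S' x) x) \<in> borel_measurable M" for n
    by (intro class_weight_measurable comb; measurable)+
  define h where "h x = lim (\<lambda>n. class_weight (l n) x x)" for x
  have [measurable]: "h \<in> borel_measurable M" unfolding h_def by measurable
  have "AE x in M. (\<forall>y. (x, y) \<in> F \<longrightarrow> (\<lambda>n. class_weight (l n) y x) \<longlonglongrightarrow> h x) \<and> E `` {x} \<subseteq> F `` {x} \<and> (S' x, x) \<in> F"
    using conv inv sub S'F
  proof eventually_elim
    case (elim x)
    have "(\<lambda>n. class_weight (l n) y x) \<longlonglongrightarrow> h x" if xy: "(x, y) \<in> F" for y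
    proof -
      obtain g where "g \<in> carrier \<Gamma>" and y: "y = a g x" using xy unfolding in_F_iff by blast
      then have "(\<lambda>n. (class_weight (l n) y x - class_weight (l n) x x) + class_weight (l n) x x) \<longlonglongrightarrow> 0 + h x"
        using elim(1,2) unfolding h_def convergent_LIMSEQ_iff by (intro tendsto_add) auto
      then show ?thesis by simp
    qed
    then show ?case using elim by blast
  qed
  from invariant_conull_set[OF this] obtain X where X[measurable]: "X \<in> sets M" and "AE x in M. x \<in> X"
    and good: "\<And>x. x \<in> X \<Longrightarrow> (\<forall>y. (x, y) \<in> F \<longrightarrow> (\<lambda>n. class_weight (l n) y x) \<longlonglongrightarrow> h x)
        \<and> E `` {x} \<subseteq> F `` {x} \<and> (S' x, x) \<in> F"
    and XF: "\<And>x y. x \<in> X \<Longrightarrow> (x, y) \<in> F \<Longrightarrow> y \<in> X" by blast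
  have limF: "(\<lambda>n. class_weight (l n) y x) \<longlonglongrightarrow> h x" if "x \<in> X" "(x, y) \<in> F" for x y
    using good that by blast
  have Xsp: "x \<in> space M" if "x \<in> X" for x using sets.sets_into_space[OF X] that by blast
  define A where "A = {x \<in> X. 1 / 2 < h x}"
  have A_eq: "A = {x \<in> space M. x \<in> X \<and> 1 / 2 < h x}" using Xsp by (auto simp: A_def)
  have A[measurable]: "A \<in> sets M" unfolding A_eq by measurable
  have hE: "h x = h y" if x: "x \<in> X" and xy: "(x, y) \<in> E" for x y
  proof -
    have F: "(x, y) \<in> F" using good[OF x] xy by blast
    then have y: "y \<in> X" using XF x by blast
    have "(\<lambda>n. class_weight (l n) x x) \<longlonglongrightarrow> h y"
      using limF[OF y F_sym[OF F]] class_weight_cong[OF xy] by simp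
    then show ?thesis using limF[OF x F_refl[OF Xsp[OF x]]] LIMSEQ_unique by blast
  qed
  have one: "(x, y) \<in> E" if x: "x \<in> A" and y: "y \<in> A" and F: "(x, y) \<in> F" for x y
  proof (rule ccontr)
    assume nE: "(x, y) \<notin> E"
    have xX: "x \<in> X" and yX: "y \<in> X" using x y by (auto simp: A_def)
    have "(\<lambda>n. class_weight (l n) x x + class_weight (l n) x y) \<longlonglongrightarrow> h x + h y"
      by (rule tendsto_add[OF limF[OF xX F_refl[OF Xsp[OF xX]]] limF[OF yX F_sym[OF F]]])
    then have "h x + h y \<le> 1"
      by (rule LIMSEQ_le_const2) (use class_weight_sum_le_1[OF l nE] in blast)
    then show False using x y by (auto simp: A_def)
  qed
  have pos: "0 < measure M A"
  proof (rule ccontr)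
    assume "\<not> 0 < measure M A"
    then have "emeasure M A = 0" by (simp add: emeasure_eq_measure not_less measure_le_0_iff)
    then have "AE x in M. x \<notin> A" by (intro AE_not_in) (auto simp: null_sets_def)
    then have hle: "AE x in M. h x \<le> 1 / 2" using \<open>AE x in M. x \<in> X\<close>
      by eventually_elim (auto simp: A_def)
    have lim: "AE x in M. (\<lambda>n. class_weight (l n) (S' x) x) \<longlonglongrightarrow> h x" using \<open>AE x in M. x \<in> X\<close>
      by eventually_elim (use good limF F_sym in blast)
    have bnd: "AE x in M. norm (class_weight (l n) (S' x) x) \<le> 1" for n
      using class_weight_bounds[OF l] by simp
    have int: "integrable M h" and
      tends: "(\<lambda>n. \<integral>x. class_weight (l n) (S' x) x \<partial>M) \<longlonglongrightarrow> (\<integral>x. h x \<partial>M)"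
      by (intro integrable_dominated_convergence[OF _ _ _ lim bnd]
          integral_dominated_convergence[OF _ _ _ lim bnd]; simp)+
    have "c \<le> (\<integral>x. class_weight (l n) (S' x) x \<partial>M)" for n
    proof -
      define \<phi> where "\<phi> g = phi M E (S \<circ> a g \<circ> S')" for g
      have "c * sum_list (map fst k) \<le> (\<Sum>(w, g)\<leftarrow>k. w * \<phi> g)"
        if "\<forall>w\<in>fst ` set k. 0 \<le> w" "combination k" for k
        using that
      proof (induction k)
        case (Cons wg k)
        obtain w g where wg: "wg = (w, g)" by (cases wg)
        have "w * c \<le> w * \<phi> g"
          using Cons.prems wg unfolding \<phi>_def by (intro mult_left_mono c) auto
        with Cons show ?case by (auto simp: wg algebra_simps)
      qed simp
      from this[of "l n"] show ?thesis
        using l[of n] unfolding integral_class_weight[OF comb S'] convex_combination_def \<phi>_def by simp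
    qed
    then have "c \<le> (\<integral>x. h x \<partial>M)" using LIMSEQ_le_const[OF tends] by blast
    also have "\<dots> \<le> (\<integral>x. 1 / 2 \<partial>M)" using hle by (intro integral_mono_AE int) auto
    also have "\<dots> = 1 / 2" by (simp add: prob_space)
    finally show False using c(1) by simp
  qed
  show ?thesis
  proof (rule that[OF A pos])
    show "AE x in M. \<forall>y. (x, y) \<in> E \<longrightarrow> (x \<in> A \<longleftrightarrow> y \<in> A)"
      using \<open>AE x in M. x \<in> X\<close>
    proof eventually_elim
      case (elim x)
      have "y \<in> X \<and> h x = h y" if xy: "(x, y) \<in> E" for y
        using good[OF elim] xy XF[OF elim] hE[OF elim xy] by blast
      then show ?case using elim unfolding A_def by auto
    qed
    show "AE x in M. x \<in> A \<longrightarrow> (\<forall>y. (x, y) \<in> F \<longrightarrow> y \<in> A \<longrightarrow> (x, y) \<in> E)"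
      using one by blast
  qed
qed

end

section \<open>The cost inequality\<close>

theorem corollary2p13:
  fixes \<Gamma> :: "('g, 'm) monoid_scheme"
    and M :: "'x measure"
    and a :: "'g \<Rightarrow> 'x \<Rightarrow> 'x"
    and E F :: "('x \<times> 'x) set"
    and S S' :: "'x \<Rightarrow> 'x"
  assumes "group \<Gamma>" and "countable (carrier \<Gamma>)"
    and "standard_probability_space M"
    and "mp_action \<Gamma> M a" and "ergodic_action \<Gamma> M a"
    and "F = orbit_equivalence \<Gamma> M a"
    and "borel_equivalence M E" and "subrelation_ae M E F"
    and "aperiodic M E"
    and "S \<in> full_group M F" and "S' \<in> full_group M F"
    and "(INF \<gamma>\<in>carrier \<Gamma>. phi M E (S \<circ> a \<gamma> \<circ> S')) > 1 / 2"
  shows "cost M F \<le> cost M E"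
proof -
  interpret prob_space M using assms(3) by (simp add: standard_probability_space_def)
  interpret pmp_action \<Gamma> M a
    by (intro pmp_action.intro pmp_action_axioms.intro assms prob_space_axioms)
  have E: "E \<in> sets (M \<Otimes>\<^sub>M M)" "equiv (space M) E"
    using assms(7) by (auto simp: borel_equivalence_def)
  have S: "S \<in> M \<rightarrow>\<^sub>M M" and S': "S' \<in> M \<rightarrow>\<^sub>M M"
    and S'F: "AE x in M. (S' x, x) \<in> orbit_equivalence \<Gamma> M a"
    using assms(6,10,11) by (auto simp: full_group_def mp_automorphism_def)
  interpret class_valued_map \<Gamma> M a E S
    by (intro class_valued_map.intro class_valued_map_axioms.intro pmp_action_axioms E S)
  have sub: "subrelation_ae M E (orbit_equivalence \<Gamma> M a)" using assms(6,8) by simp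
  have "(INF \<gamma>\<in>carrier \<Gamma>. phi M E (S \<circ> a \<gamma> \<circ> S')) \<le> phi M E (S \<circ> a g \<circ> S')"
    if "g \<in> carrier \<Gamma>" for g
    using that by (intro cINF_lower bdd_belowI[of _ 0]) (auto simp: phi_def)
  from common_class_on_positive_set[OF sub[unfolded subrelation_ae_def] S' S'F assms(12) this]
  obtain A where "A \<in> sets M" "0 < measure M A"
    "AE x in M. \<forall>y. (x, y) \<in> E \<longrightarrow> (x \<in> A \<longleftrightarrow> y \<in> A)"
    "AE x in M. x \<in> A \<longrightarrow> (\<forall>y. (x, y) \<in> orbit_equivalence \<Gamma> M a \<longrightarrow> y \<in> A \<longrightarrow> (x, y) \<in> E)"
    by blast
  then show ?thesis
    unfolding assms(6) by (intro cost_le_of_full_restriction[OF assms(5,7) sub assms(9)])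
qed

end
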